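(* Let $X_1,X_2,\dots$ be i.i.d. real random variables with distribution function $F$ having a density (so in particular $\mathbb{P}(X_1=X_2)=0$). Let $\xi_{0,n}$ be the measure on $\Delta$ associated with the $0$-th sublevel set persistence diagram of $X_1,\dots,X_n$, and let $\xi_0$ be the probability measure on $\Delta$ which is the almost sure weak limit of $\xi_{0,n}/\xi_{0,n}(\Delta)$ as $n\to\infty$. Then for every $\ell\ge0$, \[ \xi_0(\Delta_\ell)=3\,\mathbb{E}\Bigg[\bigg(\frac{1-F(X+\ell)}{1-F(X+\ell)+F(X)}\bigg)^2\Bigg], \] where $X$ has the same distribution as $X_1$.
   Context: $\Delta=\{(x,y)\in[-\infty,\infty]^2:-\infty<x<y\le\infty\}$ with the subspace topology, and $\Delta_\ell=\{(x,y)\in\Delta:y-x>\ell\}$ for $\ell\ge0$. Let $K$ be the graph (simplicial complex) with vertices $v_0,v_1,v_2,\dots$ and edges $\{v_i,v_{i+1}\}$, $i\ge 0$. For $n\ge1$ put $X_{k,n}=X_k$ for $1\le k\le n$, and $X_{k,n}=\infty$ for $k=0$ and for $k>n$. For $t\in\mathbb{R}$ let $K_n(t)=\{\sigma\in K:\max_{v_i\in\sigma}X_{i,n}\le t\}$. Homology is with $\mathbb{Z}_2$ coefficients. The persistence module $\big(H_0(K_n(t))\big)_{t\in\mathbb R}$ with maps induced by inclusions is isomorphic to $\bigoplus_{(b,d)\in PD_0}I(b,d)$ for a unique multiset $PD_0$ of points of $\Delta$ (the $0$-th persistence diagram), where $I(b,d)$ equals $\mathbb{Z}_2$ at $t$ when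 $b\le t<d$ and $0$ otherwise, with identity maps between nonzero spaces. Set $\xi_{0,n}=\sum_{(b,d)\in PD_0}\delta_{(b,d)}$ (with multiplicity). For stationary ergodic sequences whose marginals have a density and with $\mathbb{P}(X_1=X_2)=0$ (in particular for the i.i.d. sequences considered here), there is a non-random probability measure $\xi_0$ on $\Delta$ such that $\xi_{0,n}/\xi_{0,n}(\Delta)\Rightarrow\xi_0$ weakly, almost surely; this is the $\xi_0$ in the claim. *)

theory Defs
  imports
    "HOL-Probability.Probability"
    "HOL-Algebra.Coset"
    "HOL-Algebra.Product_Groups"
    "HOL-Library.Z2"
    "HOL-Library.Multiset"
begin

section \<open>Simplicial homology with coefficients in Z/2\<close>

text \<open>
  Simplices are finite nonempty sets of vertices, and a p-simplex has p + 1 vertices.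
  A chain is a finitely supported function from simplices to the field \<^typ>\<open>bit\<close>.
  Vector spaces over Z/2 are represented by their additive groups. The scalars 0 and 1 act in
  the only possible way, so group homomorphisms between such groups are the same thing as
  linear maps, and group isomorphisms the same thing as linear isomorphisms.
\<close>

definition chain_group :: "'v set set \<Rightarrow> nat \<Rightarrow> ('v set \<Rightarrow> bit) monoid" where
  "chain_group L p =
     \<lparr>carrier = {c. finite {\<sigma>. c \<sigma> \<noteq> 0} \<and> (\<forall>\<sigma>. c \<sigma> \<noteq> 0 \<longrightarrow> \<sigma> \<in> L \<and> card \<sigma> = p + 1)},
      mult = (\<lambda>c d \<sigma>. c \<sigma> + d \<sigma>),
      one = (\<lambda>\<sigma>. 0)\<rparr>"

text \<open>
  The boundary of a p-chain: the coefficient of a (p - 1)-simplex is the sum of the coefficients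
  of the p-simplices of which it is a face. Homology is not reduced, so the boundary of a
  0-chain is 0.
\<close>

definition boundary :: "nat \<Rightarrow> ('v set \<Rightarrow> bit) \<Rightarrow> ('v set \<Rightarrow> bit)" where
  "boundary p c = (\<lambda>\<tau>. if p > 0 \<and> card \<tau> = p then \<Sum>\<sigma> | c \<sigma> \<noteq> 0 \<and> \<tau> \<subseteq> \<sigma>. c \<sigma> else 0)"

definition cycle_group :: "'v set set \<Rightarrow> nat \<Rightarrow> ('v set \<Rightarrow> bit) monoid" where
  "cycle_group L p =
     (chain_group L p)\<lparr>carrier := {c \<in> carrier (chain_group L p). boundary p c = (\<lambda>\<sigma>. 0)}\<rparr>"

definition boundaries :: "'v set set \<Rightarrow> nat \<Rightarrow> ('v set \<Rightarrow> bit) set" where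
  "boundaries L p = boundary (p + 1) ` carrier (chain_group L (p + 1))"

definition simplicial_homology :: "nat \<Rightarrow> 'v set set \<Rightarrow> ('v set \<Rightarrow> bit) set monoid" where
  "simplicial_homology p L = cycle_group L p Mod boundaries L p"

text \<open>
  The map on homology induced by an inclusion of a complex into \<open>L\<close>: the class \<open>A\<close>, a coset
  in the smaller complex, is sent to the coset in \<open>L\<close> containing it.
\<close>

definition inclusion_map ::
    "nat \<Rightarrow> 'v set set \<Rightarrow> ('v set \<Rightarrow> bit) set \<Rightarrow> ('v set \<Rightarrow> bit) set" where
  "inclusion_map p L A = boundaries L p <#>\<^bsub>cycle_group L p\<^esub> A"


section \<open>Persistence modules and persistence diagrams\<close>

text \<open>The structure map from time \<open>s\<close> to time \<open>t\<close> is only meaningful for \<open>s \<le> t\<close>.\<close>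

record 'a persistence_module =
  pm_space :: "real \<Rightarrow> 'a monoid"
  pm_map :: "real \<Rightarrow> real \<Rightarrow> 'a \<Rightarrow> 'a"

definition pm_isomorphic :: "'a persistence_module \<Rightarrow> 'b persistence_module \<Rightarrow> bool" where
  "pm_isomorphic V W \<longleftrightarrow>
     (\<exists>\<phi>. (\<forall>t. \<phi> t \<in> iso (pm_space V t) (pm_space W t)) \<and>
          (\<forall>s t. s \<le> t \<longrightarrow> (\<forall>x \<in> carrier (pm_space V s).
             \<phi> t (pm_map V s t x) = pm_map W s t (\<phi> s x))))"

definition sublevel :: "'v set set \<Rightarrow> ('v \<Rightarrow> ereal) \<Rightarrow> real \<Rightarrow> 'v set set" where
  "sublevel K f t = {\<sigma> \<in> K. Max (f ` \<sigma>) \<le> ereal t}"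

definition sublevel_homology ::
    "nat \<Rightarrow> 'v set set \<Rightarrow> ('v \<Rightarrow> ereal) \<Rightarrow> ('v set \<Rightarrow> bit) set persistence_module" where
  "sublevel_homology p K f =
     \<lparr>pm_space = (\<lambda>t. simplicial_homology p (sublevel K f t)),
      pm_map = (\<lambda>s t. inclusion_map p (sublevel K f t))\<rparr>"

definition alive :: "ereal \<times> ereal \<Rightarrow> real \<Rightarrow> bool" where
  "alive q t \<longleftrightarrow> fst q \<le> ereal t \<and> ereal t < snd q"

definition interval_module :: "ereal \<times> ereal \<Rightarrow> bit persistence_module" where
  "interval_module q =
     \<lparr>pm_space = (\<lambda>t. \<lparr>carrier = (if alive q t then UNIV else {0}), mult = (+), one = 0\<rparr>),
      pm_map = (\<lambda>s t x. if alive q s \<and> alive q t then x else 0)\<rparr>"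

definition pm_direct_sum ::
    "'i set \<Rightarrow> ('i \<Rightarrow> 'a persistence_module) \<Rightarrow> ('i \<Rightarrow> 'a) persistence_module" where
  "pm_direct_sum I V =
     \<lparr>pm_space = (\<lambda>t. sum_group I (\<lambda>i. pm_space (V i) t)),
      pm_map = (\<lambda>s t x. \<lambda>i\<in>I. pm_map (V i) s t (x i))\<rparr>"

definition Delta :: "(ereal \<times> ereal) set" where
  "Delta = {(x, y). - \<infinity> < x \<and> x < y}"

definition Delta_longer :: "real \<Rightarrow> (ereal \<times> ereal) set" where
  "Delta_longer l = {(x, y) \<in> Delta. y - x > ereal l}"

text \<open>
  The direct sum is indexed by pairs \<open>(q, i)\<close>, with one index \<open>i\<close> for each occurrence of the
  point \<open>q\<close> in the multiset.
\<close>

definition is_persistence_diagram ::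
    "'a persistence_module \<Rightarrow> (ereal \<times> ereal) multiset \<Rightarrow> bool" where
  "is_persistence_diagram V D \<longleftrightarrow>
     set_mset D \<subseteq> Delta \<and>
     pm_isomorphic V
       (pm_direct_sum {(q, i :: nat). i < count D q} (\<lambda>(q, i). interval_module q))"


section \<open>The path filtered by a sequence\<close>

definition path_complex :: "nat set set" where
  "path_complex = {{i} | i. True} \<union> {{i, i + 1} | i. True}"

text \<open>Sequences are indexed from 1; the value \<open>x 0\<close> is never used.\<close>

definition truncated :: "(nat \<Rightarrow> real) \<Rightarrow> nat \<Rightarrow> nat \<Rightarrow> ereal" where
  "truncated x n k = (if 1 \<le> k \<and> k \<le> n then ereal (x k) else \<infinity>)"

definition sequence_module ::
    "nat \<Rightarrow> (nat \<Rightarrow> real) \<Rightarrow> nat \<Rightarrow> (nat set \<Rightarrow> bit) set persistence_module" where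
  "sequence_module p x n = sublevel_homology p path_complex (truncated x n)"


section \<open>Diagrams as measures, and weak convergence\<close>

text \<open>The sum of the Dirac measures at the points of \<open>D\<close>, with multiplicity, as a Borel measure
  on the subspace \<^const>\<open>Delta\<close>.\<close>

definition diagram_measure :: "(ereal \<times> ereal) multiset \<Rightarrow> (ereal \<times> ereal) measure" where
  "diagram_measure D =
     measure_of Delta (sets (restrict_space borel Delta)) (\<lambda>A. \<Sum>q\<in>#D. indicator A q)"

definition normalized :: "'a measure \<Rightarrow> 'a measure" where
  "normalized \<mu> = scale_measure (inverse (emeasure \<mu> (space \<mu>))) \<mu>"

definition weakly_converges_on ::
    "'a::topological_space set \<Rightarrow> (nat \<Rightarrow> 'a measure) \<Rightarrow> 'a measure \<Rightarrow> bool" where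
  "weakly_converges_on S \<mu> \<nu> \<longleftrightarrow>
     (\<forall>g :: 'a \<Rightarrow> real. continuous_on S g \<and> bounded (g ` S) \<longrightarrow>
        (\<lambda>n. \<integral>x. g x \<partial>\<mu> n) \<longlonglongrightarrow> (\<integral>x. g x \<partial>\<nu>))"

end

theory Submission
  imports Defs
begin

text \<open>
  The proof counts the points of the diagram of a finite sequence that are longer than \<open>l\<close>,
  takes the expectation of this count, and passes to the limit with test functions.

  A point \<open>(b, d)\<close> of the diagram of \<open>x 1, \<dots>, x n\<close> contributes to the rank of the map
  from time \<open>s\<close> to time \<open>t\<close> iff \<open>b \<le> s\<close> and \<open>t < d\<close>. Hence the number of points
  with birth \<open>b\<close> that are still alive at \<open>t = b + l\<close> is the rank from \<open>b\<close> to \<open>t\<close> minus the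
  rank from a time just before \<open>b\<close>. If the values are distinct, at most one vertex \<open>i\<close> enters
  at time \<open>b\<close>. The rank does not grow if \<open>i\<close> is joined in the complex at time \<open>t\<close> to a vertex of
  smaller value, because then the two vertices are homologous; otherwise it grows by one, because
  the parity of a chain on the component of \<open>i\<close> is a homology invariant
  (\<open>class_image_unchanged\<close>, \<open>class_image_doubled\<close>). So the points longer than \<open>l\<close> correspond
  to the indices \<open>i\<close> from which, in both directions, a value above \<open>x i + l\<close> or the end of the
  sequence is met before a value below \<open>x i\<close> (\<open>size_diagram_longer\<close>).

  For i.i.d. variables and given \<open>X i = y\<close>, the two directions are independent. With
  \<open>p = 1 - F (y + l)\<close> and \<open>q = F (y + l) - F y\<close>, the probability \<open>a m\<close> of the event for a side of
  \<open>m\<close> vertices satisfies \<open>a 0 = 1\<close> and \<open>a (m + 1) = p + q * a m\<close>, so it converges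
  geometrically to \<open>p / (1 - q)\<close>. Dominated convergence gives that the expected number of long points,
  divided by \<open>n\<close>, converges to the integral of \<open>(p / (1 - q))\<^sup>2\<close>. For \<open>l = 0\<close>
  this is the integral of \<open>(1 - F)\<^sup>2\<close>, which is \<open>1 / 3\<close> since \<open>F (X 1)\<close> is uniform; this
  is the origin of the factor 3.

  Finally, let \<open>g\<close> be a continuous function between the indicators of the sets of points longer
  than \<open>l + e\<close> and longer than \<open>l\<close>. The averages of \<open>g\<close> over the diagrams converge almost surely to
  its integral against \<open>\<xi>\<close>. As this limit is a constant, it can be taken
  out of expectations, and the limits of the expected counts give bounds on it (\<open>limit_comparison\<close>).
  Letting \<open>e\<close> tend to 0 yields the claim.
\<close>


section \<open>Chains and their classes in degree zero\<close>

text \<open>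
  These rules rewrite addition and disequalities on \<^typ>\<open>bit\<close> to Boolean form and thereby hide the
  group structure that the computations with chains rely on.
\<close>

declare add_bit_eq_xor [simp del] mult_bit_eq_and [simp del] bit_not_zero_iff [simp del]

definition vertex_chain :: "'v set \<Rightarrow> 'v set \<Rightarrow> bit" where
  "vertex_chain \<sigma> = (\<lambda>\<tau>. if \<tau> = \<sigma> then 1 else 0)"

text \<open>
  Every 0-chain is a cycle, so this coset is the homology class of \<open>c\<close>.
\<close>

definition homology_class :: "'v set set \<Rightarrow> ('v set \<Rightarrow> bit) \<Rightarrow> ('v set \<Rightarrow> bit) set" where
  "homology_class L c = (\<lambda>b \<sigma>. b \<sigma> + c \<sigma>) ` boundaries L 0"

lemma bit_add_self: "(a :: bit) + a = 0"
  by (cases a) auto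

text \<open>
  The sum in the definition ranges over the support of the chain, which changes under addition.
  Over a fixed finite set that contains the supports, additivity is visible.
\<close>

lemma boundary_eq_sum:
  assumes "finite S" "{\<sigma>. c \<sigma> \<noteq> 0} \<subseteq> S" "0 < p"
  shows "boundary p c \<tau> = (if card \<tau> = p then \<Sum>\<sigma> | \<sigma> \<in> S \<and> \<tau> \<subseteq> \<sigma>. c \<sigma> else 0)"
proof -
  have "(\<Sum>\<sigma> | c \<sigma> \<noteq> 0 \<and> \<tau> \<subseteq> \<sigma>. c \<sigma>) = (\<Sum>\<sigma> | \<sigma> \<in> S \<and> \<tau> \<subseteq> \<sigma>. c \<sigma>)"
    using assms by (intro sum.mono_neutral_left) auto
  then show ?thesis using assms by (simp add: boundary_def)
qed

lemma chain_group_add: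
  assumes "c \<in> carrier (chain_group L p)" "d \<in> carrier (chain_group L p)"
  shows "(\<lambda>\<sigma>. c \<sigma> + d \<sigma>) \<in> carrier (chain_group L p)"
proof -
  have "{\<sigma>. c \<sigma> + d \<sigma> \<noteq> 0} \<subseteq> {\<sigma>. c \<sigma> \<noteq> 0} \<union> {\<sigma>. d \<sigma> \<noteq> 0}" by auto
  then have "finite {\<sigma>. c \<sigma> + d \<sigma> \<noteq> 0}"
    using assms by (auto simp: chain_group_def elim: finite_subset)
  moreover have "c \<sigma> \<noteq> 0 \<or> d \<sigma> \<noteq> 0" if "c \<sigma> + d \<sigma> \<noteq> 0" for \<sigma> using that by auto
  ultimately show ?thesis
    using assms by (auto simp: chain_group_def)
qed

lemma chain_group_zero: "(\<lambda>\<sigma>. 0) \<in> carrier (chain_group L p)"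
  by (simp add: chain_group_def)

lemma boundary_add:
  assumes "c \<in> carrier (chain_group L p)" "d \<in> carrier (chain_group L p)"
  shows "boundary p (\<lambda>\<sigma>. c \<sigma> + d \<sigma>) = (\<lambda>\<tau>. boundary p c \<tau> + boundary p d \<tau>)"
proof (cases "0 < p")
  case True
  define S where "S = {\<sigma>. c \<sigma> \<noteq> 0} \<union> {\<sigma>. d \<sigma> \<noteq> 0}"
  have S: "finite S" "{\<sigma>. c \<sigma> \<noteq> 0} \<subseteq> S" "{\<sigma>. d \<sigma> \<noteq> 0} \<subseteq> S" "{\<sigma>. c \<sigma> + d \<sigma> \<noteq> 0} \<subseteq> S"
    using assms by (auto simp: S_def chain_group_def)
  show ?thesis
    by (rule ext) (simp add: boundary_eq_sum[OF S(1)] S True sum.distrib)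
qed (simp add: boundary_def)

lemma boundaries_zero: "(\<lambda>\<sigma>. 0) \<in> boundaries L p"
  unfolding boundaries_def
  by (rule image_eqI[where x = "\<lambda>\<sigma>. 0"]) (auto simp: boundary_def chain_group_zero fun_eq_iff)

lemma boundaries_add:
  assumes "b \<in> boundaries L p" "b' \<in> boundaries L p"
  shows "(\<lambda>\<sigma>. b \<sigma> + b' \<sigma>) \<in> boundaries L p"
proof -
  obtain c d where c: "c \<in> carrier (chain_group L (p + 1))" "b = boundary (p + 1) c"
    and d: "d \<in> carrier (chain_group L (p + 1))" "b' = boundary (p + 1) d"
    using assms unfolding boundaries_def by auto
  show ?thesis unfolding boundaries_def
    by (rule image_eqI[OF _ chain_group_add[OF c(1) d(1)]])
      (simp only: boundary_add[OF c(1) d(1)] c(2) d(2))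
qed

lemma chain_group_mono: "L \<subseteq> L' \<Longrightarrow> carrier (chain_group L p) \<subseteq> carrier (chain_group L' p)"
  by (auto simp: chain_group_def)

lemma boundaries_mono: "L \<subseteq> L' \<Longrightarrow> boundaries L p \<subseteq> boundaries L' p"
  unfolding boundaries_def by (intro image_mono chain_group_mono)

lemma homology_class_eq_iff:
  "homology_class L c = homology_class L d \<longleftrightarrow> (\<lambda>\<sigma>. c \<sigma> + d \<sigma>) \<in> boundaries L 0"
proof
  assume eq: "homology_class L c = homology_class L d"
  have "c \<in> homology_class L c"
    unfolding homology_class_def by (rule image_eqI[OF _ boundaries_zero]) simp
  then obtain b where b: "b \<in> boundaries L 0" "c = (\<lambda>\<sigma>. b \<sigma> + d \<sigma>)"
    unfolding eq by (auto simp: homology_class_def)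
  then have "(\<lambda>\<sigma>. c \<sigma> + d \<sigma>) = b"
    by (auto simp: fun_eq_iff add.assoc bit_add_self)
  with b show "(\<lambda>\<sigma>. c \<sigma> + d \<sigma>) \<in> boundaries L 0" by simp
next
  have sub: "homology_class L c \<subseteq> homology_class L d"
    if e: "(\<lambda>\<sigma>. c \<sigma> + d \<sigma>) \<in> boundaries L 0" for c d
  proof
    fix z assume "z \<in> homology_class L c"
    then obtain b where b: "b \<in> boundaries L 0" "z = (\<lambda>\<sigma>. b \<sigma> + c \<sigma>)"
      by (auto simp: homology_class_def)
    have "z = (\<lambda>\<sigma>. (b \<sigma> + (c \<sigma> + d \<sigma>)) + d \<sigma>)"
      by (auto simp: b fun_eq_iff add.assoc bit_add_self)
    then show "z \<in> homology_class L d"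
      unfolding homology_class_def using boundaries_add[OF b(1) e] by (rule image_eqI)
  qed
  assume "(\<lambda>\<sigma>. c \<sigma> + d \<sigma>) \<in> boundaries L 0"
  then show "homology_class L c = homology_class L d"
    using sub[of c d] sub[of d c] by (simp add: add.commute)
qed

lemma carrier_simplicial_homology_0:
  "carrier (simplicial_homology 0 L) = homology_class L ` carrier (chain_group L 0)"
  by (auto simp: simplicial_homology_def FactGroup_def RCOSETS_def r_coset_def cycle_group_def
      boundary_def homology_class_def chain_group_def image_def)

lemma inclusion_map_homology_class:
  assumes "L \<subseteq> L'"
  shows "inclusion_map 0 L' (homology_class L c) = homology_class L' c"
proof -
  have "inclusion_map 0 L' (homology_class L c) =
      {(\<lambda>\<sigma>. b \<sigma> + (b' \<sigma> + c \<sigma>)) | b b'. b \<in> boundaries L' 0 \<and> b' \<in> boundaries L 0}"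
    by (auto simp: inclusion_map_def set_mult_def homology_class_def cycle_group_def chain_group_def)
  also have "\<dots> = homology_class L' c"
  proof (intro equalityI subsetI)
    fix z assume "z \<in> {(\<lambda>\<sigma>. b \<sigma> + (b' \<sigma> + c \<sigma>)) | b b'. b \<in> boundaries L' 0 \<and> b' \<in> boundaries L 0}"
    then obtain b b' where z: "z = (\<lambda>\<sigma>. b \<sigma> + (b' \<sigma> + c \<sigma>))"
      and b: "b \<in> boundaries L' 0" "b' \<in> boundaries L' 0"
      using boundaries_mono[OF assms] by blast
    have "z = (\<lambda>\<sigma>. (b \<sigma> + b' \<sigma>) + c \<sigma>)" by (simp only: z add.assoc)
    then show "z \<in> homology_class L' c"
      unfolding homology_class_def using boundaries_add[OF b] by (rule image_eqI)
  next
    fix z assume "z \<in> homology_class L' c"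
    then obtain b where z: "z = (\<lambda>\<sigma>. b \<sigma> + c \<sigma>)" and b: "b \<in> boundaries L' 0"
      unfolding homology_class_def by blast
    have "z = (\<lambda>\<sigma>. b \<sigma> + (0 + c \<sigma>))" by (simp only: z add_0)
    then show "z \<in> {(\<lambda>\<sigma>. b \<sigma> + (b' \<sigma> + c \<sigma>)) | b b'. b \<in> boundaries L' 0 \<and> b' \<in> boundaries L 0}"
      by (intro CollectI exI[of _ b] exI[of _ "\<lambda>_. 0"] conjI b boundaries_zero)
  qed
  finally show ?thesis .
qed

lemma sublevel_mono: "s \<le> t \<Longrightarrow> sublevel K f s \<subseteq> sublevel K f t"
  by (auto simp: sublevel_def intro: order_trans)

text \<open>
  The image of a structure map, described by chains: the classes at time \<open>t\<close> of the chains that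
  already exist at time \<open>s\<close>.
\<close>

lemma image_sublevel_homology_0:
  assumes "s \<le> t"
  shows "pm_map (sublevel_homology 0 K f) s t ` carrier (pm_space (sublevel_homology 0 K f) s) =
    homology_class (sublevel K f t) ` carrier (chain_group (sublevel K f s) 0)"
  by (simp add: sublevel_homology_def carrier_simplicial_homology_0 image_image
      inclusion_map_homology_class[OF sublevel_mono[OF assms]])

text \<open>
  On a union of components, this is a linear functional that vanishes on boundaries; it detects
  the components that a class touches.
\<close>

definition parity_on :: "'v set \<Rightarrow> ('v set \<Rightarrow> bit) \<Rightarrow> bit" where
  "parity_on C c = (\<Sum>v\<in>C. c {v})"

lemma parity_on_add: "parity_on C (\<lambda>\<sigma>. c \<sigma> + d \<sigma>) = parity_on C c + parity_on C d"
  by (simp add: parity_on_def sum.distrib)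

text \<open>
  Since \<open>C\<close> is closed under adjacency, an edge has none or two of its vertices in \<open>C\<close>, so each
  edge contributes 0 modulo 2 after the order of summation is exchanged.
\<close>

lemma parity_on_boundary:
  assumes C: "finite C"
    and edges: "\<And>u v. u \<noteq> v \<Longrightarrow> {u, v} \<in> L \<Longrightarrow> u \<in> C \<Longrightarrow> v \<in> C"
    and b: "b \<in> boundaries L 0"
  shows "parity_on C b = 0"
proof -
  obtain c where c: "c \<in> carrier (chain_group L 1)" and b: "b = boundary 1 c"
    using b by (auto simp: boundaries_def)
  define S where "S = {\<sigma>. c \<sigma> \<noteq> 0}"
  have S: "finite S" using c by (simp add: S_def chain_group_def)
  have "parity_on C b = (\<Sum>v\<in>C. \<Sum>\<sigma> | \<sigma> \<in> S \<and> v \<in> \<sigma>. c \<sigma>)"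
    unfolding parity_on_def b using S by (intro sum.cong) (auto simp: boundary_eq_sum S_def)
  also have "\<dots> = (\<Sum>\<sigma>\<in>S. \<Sum>v | v \<in> C \<and> v \<in> \<sigma>. c \<sigma>)"
    by (rule sum.swap_restrict[OF C S])
  also have "\<dots> = (\<Sum>\<sigma>\<in>S. 0)"
  proof (rule sum.cong[OF refl])
    fix \<sigma> assume "\<sigma> \<in> S"
    then have "\<sigma> \<in> L" "card \<sigma> = 2" using c by (auto simp: S_def chain_group_def)
    then obtain u v where uv: "\<sigma> = {u, v}" "u \<noteq> v" by (auto simp: card_2_iff)
    then have "u \<in> C \<longleftrightarrow> v \<in> C"
      using edges[of u v] edges[of v u] \<open>\<sigma> \<in> L\<close> by (auto simp: insert_commute)
    then have "{w. w \<in> C \<and> w \<in> \<sigma>} = (if u \<in> C then {u, v} else {})" using uv(1) by auto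
    then show "(\<Sum>v | v \<in> C \<and> v \<in> \<sigma>. c \<sigma>) = 0"
      using \<open>u \<noteq> v\<close> by (simp add: bit_add_self)
  qed
  finally show ?thesis by simp
qed

lemma edge_boundary:
  assumes "{u, v} \<in> L" "u \<noteq> v"
  shows "(\<lambda>\<sigma>. vertex_chain {u} \<sigma> + vertex_chain {v} \<sigma>) \<in> boundaries L 0"
proof -
  have c: "vertex_chain {u, v} \<in> carrier (chain_group L 1)"
    using assms by (auto simp: vertex_chain_def chain_group_def)
  have "boundary 1 (vertex_chain {u, v}) \<tau> = vertex_chain {u} \<tau> + vertex_chain {v} \<tau>" for \<tau>
  proof -
    have "{\<sigma>. \<sigma> \<in> {{u, v}} \<and> \<tau> \<subseteq> \<sigma>} = (if \<tau> \<subseteq> {u, v} then {{u, v}} else {})" by auto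
    moreover have "card \<tau> = 1 \<and> \<tau> \<subseteq> {u, v} \<longleftrightarrow> \<tau> = {u} \<or> \<tau> = {v}"
      using \<open>u \<noteq> v\<close> by (auto simp: card_1_singleton_iff)
    ultimately show ?thesis
      using \<open>u \<noteq> v\<close> boundary_eq_sum[of "{{u, v}}" "vertex_chain {u, v}" 1 \<tau>]
      by (auto simp: vertex_chain_def)
  qed
  then have "(\<lambda>\<sigma>. vertex_chain {u} \<sigma> + vertex_chain {v} \<sigma>) = boundary (0 + 1) (vertex_chain {u, v})"
    by (simp add: fun_eq_iff)
  moreover have "vertex_chain {u, v} \<in> carrier (chain_group L (0 + 1))" using c by simp
  ultimately show ?thesis unfolding boundaries_def by (rule image_eqI)
qed


section \<open>Adding one vertex to a complex\<close>

lemma chain_group_0_cases: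
  assumes "c \<in> carrier (chain_group L 0)" "c \<sigma> \<noteq> 0"
  obtains v where "\<sigma> = {v}" "{v} \<in> L"
  using assms by (auto simp: chain_group_def card_1_singleton_iff)

lemma chain_group_0_insert:
  assumes L': "\<And>v. {v} \<in> L' \<longleftrightarrow> {v} \<in> L \<or> v = i"
  shows "carrier (chain_group L' 0) = carrier (chain_group L 0) \<union>
    (\<lambda>c \<sigma>. c \<sigma> + vertex_chain {i} \<sigma>) ` carrier (chain_group L 0)" (is "?A' = ?A \<union> ?e ` ?A")
proof (intro equalityI subsetI)
  fix c assume c: "c \<in> ?A'"
  have fin: "finite {\<sigma>. c \<sigma> \<noteq> 0}" using c by (simp add: chain_group_def)
  show "c \<in> ?A \<union> ?e ` ?A"
  proof (cases "c {i} = 0")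
    case True
    have "\<sigma> \<in> L \<and> card \<sigma> = 1" if "c \<sigma> \<noteq> 0" for \<sigma>
      using c that by (rule chain_group_0_cases) (use that True L' in auto)
    then have "c \<in> ?A" using fin by (auto simp: chain_group_def)
    then show ?thesis by blast
  next
    case False
    then have 1: "c {i} = 1" by (cases "c {i}") auto
    define c' where "c' = (\<lambda>\<sigma>. c \<sigma> + vertex_chain {i} \<sigma>)"
    have c': "c' \<sigma> = (if \<sigma> = {i} then 0 else c \<sigma>)" for \<sigma>
      using 1 by (auto simp: c'_def vertex_chain_def bit_add_self)
    have "\<sigma> \<in> L \<and> card \<sigma> = 1" if "c' \<sigma> \<noteq> 0" for \<sigma>
    proof -
      have "\<sigma> \<noteq> {i}" "c \<sigma> \<noteq> 0" using that by (auto simp: c' split: if_splits)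
      show ?thesis by (rule chain_group_0_cases[OF c \<open>c \<sigma> \<noteq> 0\<close>]) (use L' \<open>\<sigma> \<noteq> {i}\<close> in auto)
    qed
    moreover have "finite {\<sigma>. c' \<sigma> \<noteq> 0}"
      by (rule finite_subset[OF _ fin]) (auto simp: c' split: if_splits)
    ultimately have "c' \<in> ?A" by (simp add: chain_group_def)
    then have "?e c' \<in> ?e ` ?A" by (rule imageI)
    moreover have "?e c' = c"
      by (rule ext) (simp add: c'_def add.assoc bit_add_self)
    ultimately show ?thesis by simp
  qed
next
  fix c assume c: "c \<in> ?A \<union> ?e ` ?A"
  have sub: "d \<in> ?A'" if "d \<in> ?A" for d
  proof -
    have "\<sigma> \<in> L' \<and> card \<sigma> = 1" if "d \<sigma> \<noteq> 0" for \<sigma>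
      using \<open>d \<in> ?A\<close> that by (rule chain_group_0_cases) (use L' in auto)
    then show ?thesis using \<open>d \<in> ?A\<close> by (simp add: chain_group_def)
  qed
  have vertex: "vertex_chain {i} \<in> ?A'"
    using L'[of i] by (simp add: chain_group_def vertex_chain_def)
  show "c \<in> ?A'"
    using c by (elim UnE imageE) (simp_all only: sub chain_group_add[OF sub vertex])
qed

text \<open>
  The new vertex \<open>i\<close> is homologous in \<open>T\<close> to the old vertex \<open>j\<close>, so in each chain it can be
  replaced by \<open>j\<close>.
\<close>

lemma class_image_unchanged:
  assumes L': "\<And>v. {v} \<in> L' \<longleftrightarrow> {v} \<in> L \<or> v = i"
    and j: "{j} \<in> L" and b: "(\<lambda>\<sigma>. vertex_chain {i} \<sigma> + vertex_chain {j} \<sigma>) \<in> boundaries T 0"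
  shows "homology_class T ` carrier (chain_group L' 0) = homology_class T ` carrier (chain_group L 0)"
proof -
  have "homology_class T (\<lambda>\<sigma>. c \<sigma> + vertex_chain {i} \<sigma>) \<in> homology_class T ` carrier (chain_group L 0)"
    if c: "c \<in> carrier (chain_group L 0)" for c
  proof (rule image_eqI)
    have "(\<lambda>\<sigma>. (c \<sigma> + vertex_chain {i} \<sigma>) + (c \<sigma> + vertex_chain {j} \<sigma>)) =
        (\<lambda>\<sigma>. vertex_chain {i} \<sigma> + vertex_chain {j} \<sigma>)"
    proof
      fix \<sigma>
      have "(c \<sigma> + vertex_chain {i} \<sigma>) + (c \<sigma> + vertex_chain {j} \<sigma>) =
          (c \<sigma> + c \<sigma>) + (vertex_chain {i} \<sigma> + vertex_chain {j} \<sigma>)" by (simp only: ac_simps)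
      then show "(c \<sigma> + vertex_chain {i} \<sigma>) + (c \<sigma> + vertex_chain {j} \<sigma>) =
          vertex_chain {i} \<sigma> + vertex_chain {j} \<sigma>" by (simp only: bit_add_self add_0)
    qed
    then show "homology_class T (\<lambda>\<sigma>. c \<sigma> + vertex_chain {i} \<sigma>) =
        homology_class T (\<lambda>\<sigma>. c \<sigma> + vertex_chain {j} \<sigma>)"
      using b by (simp only: homology_class_eq_iff)
    show "(\<lambda>\<sigma>. c \<sigma> + vertex_chain {j} \<sigma>) \<in> carrier (chain_group L 0)"
      using c by (rule chain_group_add) (use j in \<open>auto simp: chain_group_def vertex_chain_def\<close>)
  qed
  then have "homology_class T ` (\<lambda>c \<sigma>. c \<sigma> + vertex_chain {i} \<sigma>) ` carrier (chain_group L 0) \<subseteq>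
      homology_class T ` carrier (chain_group L 0)"
    by (simp only: image_image image_subset_iff) simp
  then show ?thesis unfolding chain_group_0_insert[OF L'] image_Un by (rule Un_absorb2)
qed

text \<open>
  The parity on \<open>C\<close>, a union of components of \<open>T\<close> that the old vertices do not meet, is 0 on old
  chains and 1 on their translates by the new vertex. So the translates give new classes, and
  translation is injective on classes.
\<close>

lemma class_image_doubled:
  assumes L': "\<And>v. {v} \<in> L' \<longleftrightarrow> {v} \<in> L \<or> v = i"
    and C: "finite C" "i \<in> C" "\<And>v. v \<in> C \<Longrightarrow> {v} \<notin> L"
    and edges: "\<And>u v. u \<noteq> v \<Longrightarrow> {u, v} \<in> T \<Longrightarrow> u \<in> C \<Longrightarrow> v \<in> C"
    and fin: "finite (homology_class T ` carrier (chain_group L 0))"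
  shows "card (homology_class T ` carrier (chain_group L' 0)) =
    2 * card (homology_class T ` carrier (chain_group L 0))"
proof -
  define A where "A = carrier (chain_group L 0)"
  define e where "e = (\<lambda>(c :: 'a set \<Rightarrow> bit) \<sigma>. c \<sigma> + vertex_chain {i} \<sigma>)"
  have e_class: "homology_class T (e c) = e ` homology_class T c" for c
    by (simp add: homology_class_def e_def image_image add.assoc)
  have "inj e" by (rule injI) (simp add: e_def fun_eq_iff)
  then have inj_image: "inj_on ((`) e) S" for S
    by (intro inj_onI) (simp add: inj_image_eq_iff)
  have shift: "homology_class T ` e ` A = (`) e ` homology_class T ` A"
    by (simp only: image_image e_class)
  have card_e: "card (homology_class T ` e ` A) = card (homology_class T ` A)"
    unfolding shift by (rule card_image[OF inj_image])
  have parity_A: "parity_on C c = 0" if "c \<in> A" for c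
  proof -
    have "c {v} = 0" if "v \<in> C" for v
      using C(3)[OF that] \<open>c \<in> A\<close> by (auto simp: A_def chain_group_def)
    then show ?thesis by (simp add: parity_on_def)
  qed
  have parity_e: "parity_on C (e c) = 1" if "c \<in> A" for c
  proof -
    have "parity_on C (vertex_chain {i}) = 1"
      using C by (simp add: parity_on_def vertex_chain_def)
    then show ?thesis by (simp add: e_def parity_on_add parity_A[OF that])
  qed
  have disj: "homology_class T ` A \<inter> homology_class T ` e ` A = {}"
  proof -
    have "homology_class T c \<noteq> homology_class T (e d)" if "c \<in> A" "d \<in> A" for c d
    proof
      assume "homology_class T c = homology_class T (e d)"
      then have "(\<lambda>\<sigma>. c \<sigma> + e d \<sigma>) \<in> boundaries T 0"
        by (simp only: homology_class_eq_iff)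
      with C(1) edges have "parity_on C (\<lambda>\<sigma>. c \<sigma> + e d \<sigma>) = 0"
        by (rule parity_on_boundary)
      then show False using that by (simp add: parity_on_add parity_A parity_e)
    qed
    then show ?thesis by blast
  qed
  have split: "homology_class T ` carrier (chain_group L' 0) = homology_class T ` A \<union> homology_class T ` e ` A"
    unfolding chain_group_0_insert[OF L'] A_def e_def by (rule image_Un)
  have fin_A: "finite (homology_class T ` A)" using fin by (simp only: A_def)
  have "finite (homology_class T ` e ` A)" unfolding shift by (rule finite_imageI[OF fin_A])
  from card_Un_disjoint[OF fin_A this disj]
  have "card (homology_class T ` carrier (chain_group L' 0)) = 2 * card (homology_class T ` A)"
    by (simp only: split card_e mult_2)
  then show ?thesis by (simp only: A_def)
qed


section \<open>Ranks of a persistence module and its diagram\<close>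

lemma interval_space_simps:
  "carrier (pm_space (interval_module q) s) = (if alive q s then UNIV else {0})"
  "mult (pm_space (interval_module q) s) = (+)"
  "one (pm_space (interval_module q) s) = 0"
  "pm_map (interval_module q) s t x = (if alive q s \<and> alive q t then x else 0)"
  by (simp_all add: interval_module_def)

lemma group_interval_module: "group (pm_space (interval_module q) s)"
proof (rule groupI)
  fix x assume "x \<in> carrier (pm_space (interval_module q) s)"
  then show "\<exists>y\<in>carrier (pm_space (interval_module q) s).
      y \<otimes>\<^bsub>pm_space (interval_module q) s\<^esub> x = \<one>\<^bsub>pm_space (interval_module q) s\<^esub>"
    by (intro bexI[of _ x]) (simp_all only: interval_space_simps bit_add_self)
qed (simp_all add: interval_space_simps add.assoc split: if_splits)

text \<open>
  Ranks are measured by cardinalities of images, which isomorphisms preserve; over the field with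
  two elements, an image of rank \<open>r\<close> has \<open>2 ^ r\<close> elements.
\<close>

lemma card_image_interval_sum:
  fixes q :: "'i \<Rightarrow> ereal \<times> ereal"
  assumes I: "finite I"
  defines "W \<equiv> pm_direct_sum I (\<lambda>i. interval_module (q i))"
  shows "finite (pm_map W s t ` carrier (pm_space W s))"
    and "card (pm_map W s t ` carrier (pm_space W s)) = 2 ^ card {i \<in> I. alive (q i) s \<and> alive (q i) t}"
proof -
  define U where "U = (\<Pi>\<^sub>E i\<in>I. if alive (q i) s \<and> alive (q i) t then (UNIV :: bit set) else {0})"
  have W_carrier: "carrier (pm_space W s) = (\<Pi>\<^sub>E i\<in>I. if alive (q i) s then UNIV else {0})"
  proof -
    have "carrier (pm_space W s) = {x \<in> \<Pi>\<^sub>E i\<in>I. carrier (pm_space (interval_module (q i)) s).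
        finite {i \<in> I. x i \<noteq> \<one>\<^bsub>pm_space (interval_module (q i)) s\<^esub>}}"
      unfolding W_def pm_direct_sum_def persistence_module.simps
      by (rule carrier_sum_group[OF group_interval_module])
    then show ?thesis using I by (simp add: interval_space_simps)
  qed
  have W_map: "pm_map W s t x = (\<lambda>i\<in>I. if alive (q i) s \<and> alive (q i) t then x i else 0)" for x
    by (simp add: W_def pm_direct_sum_def interval_space_simps)
  have image: "pm_map W s t ` carrier (pm_space W s) = U"
  proof (intro equalityI subsetI)
    fix y assume "y \<in> pm_map W s t ` carrier (pm_space W s)"
    then obtain x where "y = pm_map W s t x" by blast
    then show "y \<in> U" by (simp add: W_map U_def)
  next
    fix y assume y: "y \<in> U"
    have "pm_map W s t y = y"
    proof
      fix i
      have "y i \<in> (if alive (q i) s \<and> alive (q i) t then UNIV else {0})" if "i \<in> I"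
        using y that unfolding U_def by (rule PiE_mem)
      moreover have "y i = undefined" if "i \<notin> I"
        using y that unfolding U_def by (rule PiE_arb)
      ultimately show "pm_map W s t y i = y i"
        unfolding W_map by (cases "i \<in> I"; cases "alive (q i) s \<and> alive (q i) t") simp_all
    qed
    moreover have "U \<subseteq> carrier (pm_space W s)"
      unfolding W_carrier U_def by (rule PiE_mono) simp
    ultimately show "y \<in> pm_map W s t ` carrier (pm_space W s)" using y by (metis imageI subsetD)
  qed
  have UNIV_bit: "(UNIV :: bit set) = {0, 1}" by (auto intro: bit.exhaust)
  have fin_U: "finite U" unfolding U_def using I by (intro finite_PiE) (simp_all add: UNIV_bit)
  have "card U = (\<Prod>i\<in>I. if alive (q i) s \<and> alive (q i) t then 2 else 1)"
    unfolding U_def card_PiE[OF I] by (rule prod.cong) (simp_all add: UNIV_bit)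
  also have "\<dots> = 2 ^ card {i \<in> I. alive (q i) s \<and> alive (q i) t}"
    using I by (simp add: prod.If_cases Int_def)
  finally have "card U = 2 ^ card {i \<in> I. alive (q i) s \<and> alive (q i) t}" .
  then show "finite (pm_map W s t ` carrier (pm_space W s))"
    and "card (pm_map W s t ` carrier (pm_space W s)) = 2 ^ card {i \<in> I. alive (q i) s \<and> alive (q i) t}"
    using fin_U by (simp_all add: image)
qed

lemma finite_occurrences: "finite {(q, i :: nat). i < count D q}"
proof -
  have "{(q, i). i < count D q} = (SIGMA q:set_mset D. {..<count D q})"
    by (auto intro: count_inI)
  moreover have "finite (SIGMA q:set_mset D. {..<count D q})" by (intro finite_SigmaI) simp_all
  ultimately show ?thesis by (simp only:)
qed

lemma card_occurrences:
  "card {z \<in> {(q, i :: nat). i < count D q}. P (fst z)} = size (filter_mset P D)"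
proof -
  have "{z \<in> {(q, i :: nat). i < count D q}. P (fst z)} =
      (SIGMA q:set_mset (filter_mset P D). {..<count (filter_mset P D) q})"
    by (auto intro: count_inI split: if_splits)
  also have "card \<dots> = (\<Sum>q\<in>set_mset (filter_mset P D). count (filter_mset P D) q)"
    by (subst card_SigmaI) simp_all
  also have "\<dots> = size (filter_mset P D)" by (simp only: size_multiset_overloaded_eq)
  finally show ?thesis .
qed

lemma card_image_isomorphic:
  assumes iso: "pm_isomorphic V W" and st: "s \<le> t"
    and V_map: "pm_map V s t ` carrier (pm_space V s) \<subseteq> carrier (pm_space V t)"
  shows "card (pm_map V s t ` carrier (pm_space V s)) = card (pm_map W s t ` carrier (pm_space W s))"
    and "finite (pm_map W s t ` carrier (pm_space W s)) \<Longrightarrow> finite (pm_map V s t ` carrier (pm_space V s))"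
proof -
  obtain \<phi> where \<phi>: "\<And>t. \<phi> t \<in> iso (pm_space V t) (pm_space W t)"
    and comm: "\<And>x. x \<in> carrier (pm_space V s) \<Longrightarrow> \<phi> t (pm_map V s t x) = pm_map W s t (\<phi> s x)"
    using iso st unfolding pm_isomorphic_def by blast
  have surj: "\<phi> s ` carrier (pm_space V s) = carrier (pm_space W s)"
    and inj: "inj_on (\<phi> t) (carrier (pm_space V t))"
    using \<phi>[of s] \<phi>[of t] by (auto simp: iso_def bij_betw_def)
  have "pm_map W s t ` carrier (pm_space W s) = \<phi> t ` pm_map V s t ` carrier (pm_space V s)"
    unfolding surj[symmetric] image_image by (rule image_cong[OF refl]) (simp add: comm)
  then have "bij_betw (\<phi> t) (pm_map V s t ` carrier (pm_space V s)) (pm_map W s t ` carrier (pm_space W s))"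
    using inj_on_subset[OF inj V_map] by (simp add: bij_betw_def)
  then show "card (pm_map V s t ` carrier (pm_space V s)) = card (pm_map W s t ` carrier (pm_space W s))"
    and "finite (pm_map W s t ` carrier (pm_space W s)) \<Longrightarrow> finite (pm_map V s t ` carrier (pm_space V s))"
    by (auto dest: bij_betw_same_card bij_betw_finite)
qed

lemma rank_eq_size_diagram:
  assumes D: "is_persistence_diagram (sublevel_homology 0 K f) D" and st: "s \<le> t"
  defines "R \<equiv> homology_class (sublevel K f t) ` carrier (chain_group (sublevel K f s) 0)"
  shows "finite R" and "card R = 2 ^ size {#q \<in># D. fst q \<le> ereal s \<and> ereal t < snd q#}"
proof -
  define V where "V = sublevel_homology 0 K f"
  define I where "I = {(q, i :: nat). i < count D q}"
  define W where "W = pm_direct_sum I (\<lambda>z. interval_module (fst z))"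
  have R: "pm_map V s t ` carrier (pm_space V s) = R"
    unfolding V_def R_def by (rule image_sublevel_homology_0[OF st])
  have "pm_isomorphic V W"
    using D by (simp add: is_persistence_diagram_def V_def W_def I_def case_prod_unfold)
  moreover have "R \<subseteq> carrier (pm_space V t)"
    unfolding V_def R_def sublevel_homology_def persistence_module.simps carrier_simplicial_homology_0
    by (intro image_mono chain_group_mono sublevel_mono st)
  moreover have I: "finite I" unfolding I_def by (rule finite_occurrences)
  moreover have "card {z \<in> I. alive (fst z) s \<and> alive (fst z) t} =
      size {#q \<in># D. fst q \<le> ereal s \<and> ereal t < snd q#}"
  proof -
    have alive_iff: "alive q s \<and> alive q t \<longleftrightarrow> fst q \<le> ereal s \<and> ereal t < snd q" for q
      using st unfolding alive_def by (meson ereal_less_eq(3) le_less_trans order_trans)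
    show ?thesis unfolding I_def alive_iff by (rule card_occurrences)
  qed
  ultimately show "finite R" "card R = 2 ^ size {#q \<in># D. fst q \<le> ereal s \<and> ereal t < snd q#}"
    using card_image_isomorphic[of V W s t] st card_image_interval_sum[OF I, of fst s t]
    unfolding R W_def by simp_all
qed


section \<open>Counting the points of the diagram of a sequence\<close>

abbreviation path_sublevel :: "nat \<Rightarrow> (nat \<Rightarrow> real) \<Rightarrow> real \<Rightarrow> nat set set" where
  "path_sublevel n x \<equiv> sublevel path_complex (truncated x n)"

lemma truncated_le_iff: "truncated x n v \<le> ereal t \<longleftrightarrow> v \<in> {1..n} \<and> x v \<le> t"
  by (auto simp: truncated_def)

lemma vertex_in_path_sublevel: "{v} \<in> path_sublevel n x t \<longleftrightarrow> v \<in> {1..n} \<and> x v \<le> t"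
  by (auto simp: sublevel_def path_complex_def truncated_le_iff)

lemma edge_in_path_sublevel:
  assumes "u \<noteq> v"
  shows "{u, v} \<in> path_sublevel n x t \<longleftrightarrow>
    (v = u + 1 \<or> u = v + 1) \<and> u \<in> {1..n} \<and> v \<in> {1..n} \<and> x u \<le> t \<and> x v \<le> t"
proof -
  have "{u, v} \<in> path_complex \<longleftrightarrow> v = u + 1 \<or> u = v + 1"
    using assms by (auto simp: path_complex_def doubleton_eq_iff)
  then show ?thesis by (auto simp: sublevel_def truncated_le_iff)
qed

text \<open>
  In the boundary of the sum of the edges from \<open>i\<close> to \<open>j\<close>, the inner vertices cancel.
\<close>

lemma path_boundary:
  assumes "i \<le> j" "\<And>k. i \<le> k \<Longrightarrow> k \<le> j \<Longrightarrow> {k} \<in> path_sublevel n x t"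
  shows "(\<lambda>\<sigma>. vertex_chain {i} \<sigma> + vertex_chain {j} \<sigma>) \<in> boundaries (path_sublevel n x t) 0"
  using assms
proof (induction j rule: dec_induct)
  case base
  show ?case by (simp add: bit_add_self boundaries_zero)
next
  case (step j)
  have "{j, j + 1} \<in> path_sublevel n x t"
    using step.prems[of j] step.prems[of "j + 1"] step.hyps
    by (simp add: edge_in_path_sublevel vertex_in_path_sublevel)
  then have "(\<lambda>\<sigma>. vertex_chain {j} \<sigma> + vertex_chain {j + 1} \<sigma>) \<in> boundaries (path_sublevel n x t) 0"
    by (rule edge_boundary) simp
  moreover have "(\<lambda>\<sigma>. vertex_chain {i} \<sigma> + vertex_chain {j} \<sigma>) \<in> boundaries (path_sublevel n x t) 0"
    using step.prems by (intro step.IH) simp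
  ultimately have "(\<lambda>\<sigma>. (vertex_chain {i} \<sigma> + vertex_chain {j} \<sigma>) +
      (vertex_chain {j} \<sigma> + vertex_chain {j + 1} \<sigma>)) \<in> boundaries (path_sublevel n x t) 0"
    by (rule boundaries_add[rotated])
  moreover have "(a + b) + (b + c) = a + c" for a b c :: bit
    using bit_add_self[of b] by (simp add: add.assoc flip: add.assoc[of b b c])
  ultimately show ?case by (simp only: Suc_eq_plus1)
qed

text \<open>
  The component of \<open>i\<close> in the complex at time \<open>t\<close> has a vertex of smaller value.
\<close>

definition merges_below :: "nat \<Rightarrow> (nat \<Rightarrow> real) \<Rightarrow> real \<Rightarrow> nat \<Rightarrow> bool" where
  "merges_below n x t i \<longleftrightarrow>
     (\<exists>j\<in>{1..n}. x j < x i \<and> (\<forall>k\<in>{min i j..max i j}. x k \<le> t))"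

text \<open>
  In the second case \<open>C\<close> is the component of \<open>i\<close> at time \<open>t\<close>. All its other vertices have
  larger values than \<open>i\<close>, by assumption, so none of them is present at time \<open>s\<close>.
\<close>

lemma card_class_image_step:
  fixes x :: "nat \<Rightarrow> real" and n :: nat
  defines "R \<equiv> \<lambda>s t. homology_class (path_sublevel n x t) ` carrier (chain_group (path_sublevel n x s) 0)"
  assumes inj: "inj_on x {1..n}" and i: "i \<in> {1..n}" and it: "x i \<le> t"
    and s: "s < x i" "\<And>k. k \<in> {1..n} \<Longrightarrow> x k < x i \<Longrightarrow> x k \<le> s"
    and fin: "finite (R s t)"
  shows "card (R (x i) t) = (if merges_below n x t i then 1 else 2) * card (R s t)"
proof -
  have vertices: "{v} \<in> path_sublevel n x (x i) \<longleftrightarrow> {v} \<in> path_sublevel n x s \<or> v = i" for v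
  proof -
    have "x v \<le> x i \<longleftrightarrow> x v \<le> s \<or> v = i" if "v \<in> {1..n}"
      using s inj_onD[OF inj _ that i] that by force
    then show ?thesis using i by (auto simp: vertex_in_path_sublevel)
  qed
  show ?thesis
  proof (cases "merges_below n x t i")
    case True
    then obtain j where j: "j \<in> {1..n}" "x j < x i" and low: "\<And>k. k \<in> {min i j..max i j} \<Longrightarrow> x k \<le> t"
      unfolding merges_below_def by blast
    have "{k} \<in> path_sublevel n x t" if "min i j \<le> k" "k \<le> max i j" for k
      using i j(1) low[of k] that by (auto simp: vertex_in_path_sublevel min_le_iff_disj le_max_iff_disj)
    then have "(\<lambda>\<sigma>. vertex_chain {min i j} \<sigma> + vertex_chain {max i j} \<sigma>) \<in> boundaries (path_sublevel n x t) 0"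
      by (intro path_boundary) simp_all
    then have "(\<lambda>\<sigma>. vertex_chain {i} \<sigma> + vertex_chain {j} \<sigma>) \<in> boundaries (path_sublevel n x t) 0"
      by (cases "i \<le> j") (simp_all add: add.commute min_absorb1 min_absorb2 max_absorb1 max_absorb2)
    moreover have "{j} \<in> path_sublevel n x s" using j s by (simp add: vertex_in_path_sublevel)
    ultimately have "R (x i) t = R s t"
      unfolding R_def using class_image_unchanged[of "path_sublevel n x (x i)", OF vertices] by (simp only:)
    then show ?thesis using True by simp
  next
    case False
    define C where "C = {j \<in> {1..n}. \<forall>k\<in>{min i j..max i j}. x k \<le> t}"
    have "card (R (x i) t) = 2 * card (R s t)"
      unfolding R_def
    proof (rule class_image_doubled[OF vertices])
      show "finite C" by (simp add: C_def)
      show "i \<in> C" using i it by (simp add: C_def)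
      show "{v} \<notin> path_sublevel n x s" if "v \<in> C" for v
      proof
        assume "{v} \<in> path_sublevel n x s"
        then have "x v < x i" using s(1) by (simp add: vertex_in_path_sublevel)
        then have "merges_below n x t i"
          using that unfolding merges_below_def C_def by blast
        then show False using False by contradiction
      qed
      show "v \<in> C" if "u \<noteq> v" "{u, v} \<in> path_sublevel n x t" "u \<in> C" for u v
      proof -
        have uv: "v = u + 1 \<or> u = v + 1" "v \<in> {1..n}" "x v \<le> t"
          using that(2) unfolding edge_in_path_sublevel[OF that(1)] by blast+
        have "x k \<le> t" if "k \<in> {min i v..max i v}" for k
        proof -
          have "k = v \<or> k \<in> {min i u..max i u}"
            using that uv(1) by (auto simp: min_def max_def split: if_splits)
          then show ?thesis using \<open>u \<in> C\<close> uv(3) by (auto simp: C_def)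
        qed
        then show ?thesis using uv(2) by (simp add: C_def)
      qed
      show "finite (homology_class (path_sublevel n x t) ` carrier (chain_group (path_sublevel n x s) 0))"
        using fin by (simp only: R_def)
    qed
    then show ?thesis using False by simp
  qed
qed

text \<open>
  The left-hand side is the difference of the ranks from \<open>b\<close> and from a time \<open>s\<close> just before
  \<open>b\<close>, both to \<open>t\<close>; it is enough to see how the image of the structure map grows between \<open>s\<close> and
  \<open>b\<close>.
\<close>

lemma size_births:
  assumes inj: "inj_on x {1..n}" and D: "is_persistence_diagram (sequence_module 0 x n) D" and bt: "b \<le> t"
  shows "size {#q \<in># D. fst q = ereal b \<and> ereal t < snd q#} =
    (if \<exists>i\<in>{1..n}. x i = b \<and> \<not> merges_below n x t i then 1 else 0)"
proof -
  define R where "R = (\<lambda>s. homology_class (path_sublevel n x t) ` carrier (chain_group (path_sublevel n x s) 0))"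
  define r where "r = (\<lambda>s. size {#q \<in># D. fst q \<le> ereal s \<and> ereal t < snd q#})"
  have R: "finite (R s)" "card (R s) = 2 ^ r s" if "s \<le> t" for s
    using rank_eq_size_diagram[OF D[unfolded sequence_module_def] that] unfolding R_def r_def by simp_all
  \<comment> \<open>No vertex enters and no point is born in the half-open interval from \<open>s\<close> to \<open>b\<close>, with \<open>b\<close>
    excluded; the element \<open>b - 1\<close> only makes the set nonempty.\<close>
  define S where "S = insert (b - 1) {y. y < b \<and> (y \<in> x ` {1..n} \<or> ereal y \<in> fst ` set_mset D)}"
  define s where "s = Max S"
  have "finite (ereal -` fst ` set_mset D)" by (rule finite_vimageI) (simp_all add: inj_def)
  moreover have "S \<subseteq> insert (b - 1) (x ` {1..n} \<union> ereal -` fst ` set_mset D)"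
    unfolding S_def by blast
  ultimately have finS: "finite S" by (metis finite_Un finite_atLeastAtMost finite_imageI finite_insert finite_subset)
  have "s \<in> S" unfolding s_def using finS by (intro Max_in) (auto simp: S_def)
  then have sb: "s < b" by (auto simp: S_def)
  have below: "y \<le> s" if "y \<in> S" for y unfolding s_def using finS that by (rule Max_ge)
  have r_split: "r b = r s + size {#q \<in># D. fst q = ereal b \<and> ereal t < snd q#}"
  proof -
    have "fst q \<le> ereal b \<longleftrightarrow> fst q \<le> ereal s \<or> fst q = ereal b" if "q \<in># D" for q
    proof -
      have q: "fst q \<in> fst ` set_mset D" using that by simp
      show ?thesis
      proof (cases "fst q")
        case (real r)
        have "r \<le> s" if "r < b" using below[of r] q real that by (simp add: S_def)
        then show ?thesis using sb real by auto
      qed simp_all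
    qed
    then have "{#q \<in># D. fst q \<le> ereal b \<and> ereal t < snd q#} =
        {#q \<in># D. (fst q \<le> ereal s \<and> ereal t < snd q) \<or> (fst q = ereal b \<and> ereal t < snd q)#}"
      by (intro filter_mset_cong) auto
    also have "\<dots> = {#q \<in># D. fst q \<le> ereal s \<and> ereal t < snd q#} +
        {#q \<in># D. fst q = ereal b \<and> ereal t < snd q#}"
      using sb by (intro multiset_eqI) auto
    finally show ?thesis by (simp add: r_def)
  qed
  show ?thesis
  proof (cases "b \<in> x ` {1..n}")
    case True
    then obtain i where i: "i \<in> {1..n}" "b = x i" by auto
    have "card (R (x i)) = (if merges_below n x t i then 1 else 2) * card (R s)"
      unfolding R_def
    proof (rule card_class_image_step[OF inj i(1)])
      show "x k \<le> s" if "k \<in> {1..n}" "x k < x i" for k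
        using below[of "x k"] that i by (simp add: S_def)
      show "finite (homology_class (path_sublevel n x t) ` carrier (chain_group (path_sublevel n x s) 0))"
        using R(1)[of s] sb bt by (simp add: R_def)
    qed (use sb bt i in simp_all)
    then have "(2::nat) ^ r b = (if merges_below n x t i then 1 else 2) * 2 ^ r s"
      using R(2)[of s] R(2)[of b] sb bt i by simp
    then have "(2::nat) ^ r b = 2 ^ (r s + (if merges_below n x t i then 0 else 1))"
      by (simp split: if_splits)
    then have "r b = r s + (if merges_below n x t i then 0 else 1)"
      by (subst (asm) power_inject_exp) simp_all
    moreover have "(\<exists>i'\<in>{1..n}. x i' = b \<and> \<not> merges_below n x t i') \<longleftrightarrow> \<not> merges_below n x t i"
      using inj_onD[OF inj _ _ i(1)] i by blast
    ultimately show ?thesis using r_split by simp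
  next
    case False
    have "x k \<le> b \<longleftrightarrow> x k \<le> s" if "k \<in> {1..n}" for k
      using below[of "x k"] that False sb by (force simp: S_def)
    then have "({v} \<in> path_sublevel n x b) = ({v} \<in> path_sublevel n x s)" for v
      by (auto simp: vertex_in_path_sublevel)
    then have "carrier (chain_group (path_sublevel n x b) 0) = carrier (chain_group (path_sublevel n x s) 0)"
      by (auto simp: chain_group_def card_1_singleton_iff)
    then have "R b = R s" by (simp only: R_def)
    then have "(2::nat) ^ r b = 2 ^ r s" using R(2)[of s] R(2)[of b] sb bt by simp
    then have "r b = r s" by simp
    then show ?thesis using r_split False by auto
  qed
qed

definition persists :: "nat \<Rightarrow> (nat \<Rightarrow> real) \<Rightarrow> real \<Rightarrow> nat \<Rightarrow> bool" where
  "persists n x l i \<longleftrightarrow> \<not> merges_below n x (x i + l) i"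

lemma count_image_filter_mset:
  "count (image_mset f (filter_mset P D)) z = size {#q \<in># D. f q = z \<and> P q#}"
  by (induction D) auto

text \<open>
  For each possible birth there is at most one long point, so the multiset of the births of the long
  points is the set of the values of the persisting indices.
\<close>

lemma size_diagram_longer:
  assumes inj: "inj_on x {1..n}" and D: "is_persistence_diagram (sequence_module 0 x n) D" and l: "0 \<le> l"
  shows "size {#q \<in># D. q \<in> Delta_longer l#} = card {i \<in> {1..n}. persists n x l i}"
proof -
  define P where "P = {i \<in> {1..n}. persists n x l i}"
  have D_Delta: "set_mset D \<subseteq> Delta" using D by (simp add: is_persistence_diagram_def)
  have inj_P: "inj_on (\<lambda>i. ereal (x i)) P"
    by (rule inj_onI) (simp add: P_def inj_onD[OF inj])
  have "image_mset fst {#q \<in># D. q \<in> Delta_longer l#} = mset_set ((\<lambda>i. ereal (x i)) ` P)"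
  proof (rule multiset_eqI)
    fix z :: ereal
    have "count (image_mset fst {#q \<in># D. q \<in> Delta_longer l#}) z =
        size {#q \<in># D. fst q = z \<and> q \<in> Delta_longer l#}"
      by (rule count_image_filter_mset)
    also have "\<dots> = count (mset_set ((\<lambda>i. ereal (x i)) ` P)) z"
    proof (cases z)
      case (real b)
      have "{#q \<in># D. fst q = z \<and> q \<in> Delta_longer l#} = {#q \<in># D. fst q = ereal b \<and> ereal (b + l) < snd q#}"
      proof (rule filter_mset_cong[OF refl])
        fix q assume "q \<in># D"
        then have "q \<in> Delta" using D_Delta by blast
        moreover have "snd q - ereal b > ereal l \<longleftrightarrow> ereal (b + l) < snd q"
          by (cases "snd q") auto
        ultimately show "(fst q = z \<and> q \<in> Delta_longer l) = (fst q = ereal b \<and> ereal (b + l) < snd q)"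
          by (cases q) (auto simp: real Delta_longer_def)
      qed
      then have "size {#q \<in># D. fst q = z \<and> q \<in> Delta_longer l#} =
          (if \<exists>i\<in>{1..n}. x i = b \<and> \<not> merges_below n x (b + l) i then 1 else 0)"
        using size_births[OF inj D, of b "b + l"] l by simp
      also have "\<dots> = (if z \<in> (\<lambda>i. ereal (x i)) ` P then 1 else 0)"
        by (auto simp: real P_def persists_def)
      finally show ?thesis by (simp add: P_def count_mset_set')
    next
      case PInf
      have "{#q \<in># D. fst q = z \<and> q \<in> Delta_longer l#} = {#}"
        by (auto simp: PInf Delta_longer_def Delta_def)
      then show ?thesis by (auto simp: PInf count_mset_set')
    next
      case MInf
      have "{#q \<in># D. fst q = z \<and> q \<in> Delta_longer l#} = {#}"
        by (auto simp: MInf Delta_longer_def Delta_def)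
      then show ?thesis by (auto simp: MInf count_mset_set')
    qed
    finally show "count (image_mset fst {#q \<in># D. q \<in> Delta_longer l#}) z =
        count (mset_set ((\<lambda>i. ereal (x i)) ` P)) z" .
  qed
  then have "size (image_mset fst {#q \<in># D. q \<in> Delta_longer l#}) = card ((\<lambda>i. ereal (x i)) ` P)"
    by simp
  then show ?thesis using card_image[OF inj_P] by (simp only: size_image_mset P_def)
qed


section \<open>Diagram measures and continuous test functions\<close>

lemma sum_indicator_mset: "(\<Sum>q\<in>#D. indicator A q) = (of_nat (size {#q \<in># D. q \<in> A#}) :: ennreal)"
  by (induction D) (auto simp: indicator_def)

lemma space_restrict_Delta: "space (restrict_space borel Delta) = Delta"
  by (simp add: space_restrict_space)

lemma diagram_measure_simps:
  shows space_diagram_measure: "space (diagram_measure D) = Delta"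
    and sets_diagram_measure: "sets (diagram_measure D) = sets (restrict_space borel Delta)"
    and emeasure_diagram_measure: "A \<in> sets (restrict_space borel Delta) \<Longrightarrow>
      emeasure (diagram_measure D) A = of_nat (size {#q \<in># D. q \<in> A#})"
proof -
  interpret sigma_algebra Delta "sets (restrict_space borel Delta)"
    using sets.sigma_algebra_axioms[of "restrict_space borel Delta"] by (simp add: space_restrict_Delta)
  show "space (diagram_measure D) = Delta"
    "sets (diagram_measure D) = sets (restrict_space borel Delta)"
    by (simp_all add: diagram_measure_def)
  have "countably_additive (sets (restrict_space borel Delta)) (\<lambda>A. \<Sum>q\<in>#D. indicator A q :: ennreal)"
  proof (rule countably_additiveI)
    fix A :: "nat \<Rightarrow> (ereal \<times> ereal) set" assume "disjoint_family A"
    then show "(\<Sum>i. \<Sum>q\<in>#D. indicator (A i) q :: ennreal) = (\<Sum>q\<in>#D. indicator (\<Union>i. A i) q)"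
      by (induction D) (simp_all add: suminf_indicator flip: suminf_add)
  qed
  moreover have "positive (sets (restrict_space borel Delta)) (\<lambda>A. \<Sum>q\<in>#D. indicator A q :: ennreal)"
    by (simp add: positive_def)
  ultimately show "emeasure (diagram_measure D) A = of_nat (size {#q \<in># D. q \<in> A#})"
    if "A \<in> sets (restrict_space borel Delta)"
    unfolding diagram_measure_def sum_indicator_mset[symmetric]
    using that by (intro emeasure_measure_of_sigma sigma_algebra_axioms)
qed

lemma normalized_diagram_measure:
  assumes "set_mset D \<subseteq> Delta" "D \<noteq> {#}"
  shows "prob_space (normalized (diagram_measure D))"
    and "sets (normalized (diagram_measure D)) = sets (restrict_space borel Delta)"
    and "A \<in> sets (restrict_space borel Delta) \<Longrightarrow>
      measure (normalized (diagram_measure D)) A = real (size {#q \<in># D. q \<in> A#}) / real (size D)"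
proof -
  have all: "{#q \<in># D. q \<in> Delta#} = D" using assms by (auto simp: filter_mset_eq_conv)
  have "Delta \<in> sets (restrict_space borel Delta)"
    using sets.top[of "restrict_space borel Delta"] by (simp only: space_restrict_Delta)
  then have total: "emeasure (diagram_measure D) (space (diagram_measure D)) = of_nat (size D)"
    by (simp add: emeasure_diagram_measure space_diagram_measure all)
  have em: "emeasure (normalized (diagram_measure D)) A = ennreal (real (size {#q \<in># D. q \<in> A#}) / real (size D))"
    if "A \<in> sets (restrict_space borel Delta)" for A
  proof -
    have "emeasure (normalized (diagram_measure D)) A =
        of_nat (size {#q \<in># D. q \<in> A#}) / of_nat (size D)"
      by (simp add: normalized_def total emeasure_diagram_measure[OF that] divide_ennreal_def mult.commute)
    then show ?thesis
      using assms(2) by (simp add: ennreal_of_nat_eq_real_of_nat divide_ennreal nonempty_has_size)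
  qed
  have "space (normalized (diagram_measure D)) = Delta"
    using sets_eq_imp_space_eq[of "normalized (diagram_measure D)" "diagram_measure D"]
    by (simp add: normalized_def space_diagram_measure)
  then show "prob_space (normalized (diagram_measure D))"
    using assms em[OF \<open>Delta \<in> _\<close>] by (intro prob_spaceI) (simp add: all)
  show "sets (normalized (diagram_measure D)) = sets (restrict_space borel Delta)"
    by (simp add: normalized_def sets_diagram_measure)
  show "measure (normalized (diagram_measure D)) A = real (size {#q \<in># D. q \<in> A#}) / real (size D)"
    if "A \<in> sets (restrict_space borel Delta)"
    using em[OF that] by (simp add: measure_def)
qed

text \<open>
  The length of a point may be infinite. Capping makes it real, and continuity on \<^const>\<open>Delta\<close> is
  kept because the birth is always finite there.
\<close>

definition capped_length :: "real \<Rightarrow> ereal \<times> ereal \<Rightarrow> real" where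
  "capped_length r q = real_of_ereal (min (snd q - fst q) (ereal r))"

lemma capped_length_greater_iff:
  assumes "q \<in> Delta" "a < r" "0 < r"
  shows "a < capped_length r q \<longleftrightarrow> ereal a < snd q - fst q"
proof -
  obtain x y where q: "q = (x, y)" and xy: "- \<infinity> < x" "x < y" using assms by (auto simp: Delta_def)
  obtain b where x: "x = ereal b" using xy by (cases x) auto
  show ?thesis using assms(2,3) xy by (cases y) (auto simp: q x capped_length_def min_def)
qed

lemma continuous_on_capped_length:
  assumes "0 < r"
  shows "continuous_on Delta (capped_length r)"
proof -
  have "((\<lambda>q. real_of_ereal (min (snd q - fst q) (ereal r))) \<longlongrightarrow>
      real_of_ereal (min (snd q - fst q) (ereal r))) (at q within Delta)"
    if "q \<in> Delta" for q :: "ereal \<times> ereal"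
  proof -
    have fin: "\<bar>fst q\<bar> \<noteq> \<infinity>" and pos: "0 < snd q - fst q"
      using that by (cases "fst q"; cases "snd q"; auto simp: Delta_def)+
    have "((\<lambda>q. snd q + - fst q) \<longlongrightarrow> snd q + - fst q) (at q within Delta)"
      using fin by (intro tendsto_add_ereal_general1 tendsto_uminus_ereal tendsto_fst tendsto_snd tendsto_ident_at) simp
    then have "((\<lambda>q. min (snd q - fst q) (ereal r)) \<longlongrightarrow> min (snd q - fst q) (ereal r)) (at q within Delta)"
      by (intro tendsto_min tendsto_const) (simp add: minus_ereal_def)
    moreover have "\<bar>min (snd q - fst q) (ereal r)\<bar> \<noteq> \<infinity>"
      using pos by (cases "snd q - fst q") (auto simp: min_def)
    ultimately show ?thesis by (intro lim_real_of_ereal) (simp add: ereal_real')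
  qed
  then show ?thesis unfolding continuous_on_def capped_length_def by blast
qed

lemma mem_Delta_longer: "q \<in> Delta_longer l \<longleftrightarrow> q \<in> Delta \<and> ereal l < snd q - fst q"
  by (cases q) (simp add: Delta_longer_def)

lemma Delta_longer_antimono: "l \<le> l' \<Longrightarrow> Delta_longer l' \<subseteq> Delta_longer l"
  unfolding subset_iff mem_Delta_longer by (meson ereal_less_eq(3) le_less_trans)

lemma Delta_longer_sets:
  assumes "0 \<le> l"
  shows "Delta_longer l \<in> sets (restrict_space borel Delta)"
proof -
  have "capped_length (l + 1) \<in> borel_measurable (restrict_space borel Delta)"
    using assms by (intro borel_measurable_continuous_on_restrict continuous_on_capped_length) simp
  then have "{q \<in> space (restrict_space borel Delta). l < capped_length (l + 1) q} \<in> sets (restrict_space borel Delta)"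
    by (intro borel_measurable_less borel_measurable_const)
  also have "{q \<in> space (restrict_space borel Delta). l < capped_length (l + 1) q} = Delta_longer l"
    using assms capped_length_greater_iff[of _ l "l + 1"]
    by (auto simp: space_restrict_Delta Delta_longer_def)
  finally show ?thesis .
qed

text \<open>
  As a function of the length: 0 up to \<open>l\<close>, then linear, and 1 from \<open>l + e\<close> on, because the length
  is capped there.
\<close>

definition ramp :: "real \<Rightarrow> real \<Rightarrow> ereal \<times> ereal \<Rightarrow> real" where
  "ramp l e q = max 0 ((capped_length (l + e) q - l) / e)"

lemma
  assumes l: "0 \<le> l" and e: "0 < e"
  shows continuous_on_ramp: "continuous_on Delta (ramp l e)"
    and ramp_nonneg: "0 \<le> ramp l e q"
    and ramp_le_indicator: "q \<in> Delta \<Longrightarrow> ramp l e q \<le> indicator (Delta_longer l) q"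
    and indicator_le_ramp: "q \<in> Delta \<Longrightarrow> indicator (Delta_longer (l + e)) q \<le> ramp l e q"
proof -
  show "continuous_on Delta (ramp l e)"
    unfolding ramp_def using l e by (intro continuous_intros continuous_on_capped_length) auto
  show "0 \<le> ramp l e q" by (simp add: ramp_def)
  assume q: "q \<in> Delta"
  obtain x y where xy: "q = (x, y)" "- \<infinity> < x" "x < y" using q by (auto simp: Delta_def)
  obtain b where x: "x = ereal b" using xy by (cases x) auto
  have "capped_length (l + e) q \<le> l + e"
    using l e xy by (cases y) (auto simp: capped_length_def x min_def)
  moreover have "l < capped_length (l + e) q \<longleftrightarrow> q \<in> Delta_longer l"
    using capped_length_greater_iff[OF q, of l "l + e"] l e q xy by (auto simp: Delta_longer_def)
  ultimately show "ramp l e q \<le> indicator (Delta_longer l) q"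
    using e by (auto simp: ramp_def indicator_def divide_le_eq)
  have "capped_length (l + e) q = l + e" if "q \<in> Delta_longer (l + e)"
    using that l e by (cases y) (auto simp: capped_length_def xy x min_def Delta_longer_def)
  then show "indicator (Delta_longer (l + e)) q \<le> ramp l e q"
    using e by (auto simp: ramp_def indicator_def)
qed

lemma integral_ramp_bounds:
  assumes P: "prob_space P" and sets: "sets P = sets (restrict_space borel Delta)"
    and l: "0 \<le> l" and e: "0 < e"
  shows "measure P (Delta_longer (l + e)) \<le> (\<integral>q. ramp l e q \<partial>P)"
    and "(\<integral>q. ramp l e q \<partial>P) \<le> measure P (Delta_longer l)"
proof -
  interpret prob_space P by fact
  have space: "space P = Delta" using sets_eq_imp_space_eq[OF sets] by (simp add: space_restrict_Delta)
  have meas: "Delta_longer l \<in> sets P" "Delta_longer (l + e) \<in> sets P"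
    using l e by (simp_all add: sets Delta_longer_sets)
  have "ramp l e \<in> borel_measurable (restrict_space borel Delta)"
    using l e by (intro borel_measurable_continuous_on_restrict continuous_on_ramp)
  then have "ramp l e \<in> borel_measurable P" by (simp only: measurable_cong_sets[OF sets refl])
  moreover have "norm (ramp l e q) \<le> 1" if "q \<in> space P" for q
    using ramp_nonneg[OF l e, of q] ramp_le_indicator[OF l e, of q] that
    by (cases "q \<in> Delta_longer l") (simp_all add: space)
  ultimately have int: "integrable P (ramp l e)"
    by (intro integrable_const_bound[of _ 1] AE_I2)
  have "measure P (Delta_longer (l + e)) = (\<integral>q. indicator (Delta_longer (l + e)) q \<partial>P)"
    using meas by simp
  also have "\<dots> \<le> (\<integral>q. ramp l e q \<partial>P)"
    using meas int indicator_le_ramp[OF l e]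
    by (intro integral_mono) (auto simp: space emeasure_eq_measure)
  finally show "measure P (Delta_longer (l + e)) \<le> (\<integral>q. ramp l e q \<partial>P)" .
  have "(\<integral>q. ramp l e q \<partial>P) \<le> (\<integral>q. indicator (Delta_longer l) q \<partial>P)"
    using meas int ramp_le_indicator[OF l e]
    by (intro integral_mono) (auto simp: space emeasure_eq_measure)
  also have "\<dots> = measure P (Delta_longer l)" using meas by simp
  finally show "(\<integral>q. ramp l e q \<partial>P) \<le> measure P (Delta_longer l)" .
qed

lemma measure_Delta_longer_tendsto:
  assumes P: "prob_space P" and sets: "sets P = sets (restrict_space borel Delta)" and l: "0 \<le> l"
  shows "(\<lambda>n. measure P (Delta_longer (l + 1 / real (Suc n)))) \<longlonglongrightarrow> measure P (Delta_longer l)"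
proof -
  interpret prob_space P by fact
  have "(\<lambda>n. measure P (Delta_longer (l + 1 / real (Suc n)))) \<longlonglongrightarrow>
      measure P (\<Union>n. Delta_longer (l + 1 / real (Suc n)))"
  proof (rule finite_Lim_measure_incseq)
    show "range (\<lambda>n. Delta_longer (l + 1 / real (Suc n))) \<subseteq> sets P"
      using l by (auto simp: sets intro!: Delta_longer_sets)
    show "incseq (\<lambda>n. Delta_longer (l + 1 / real (Suc n)))"
    proof (rule monoI)
      fix m n :: nat assume "m \<le> n"
      then show "Delta_longer (l + 1 / real (Suc m)) \<subseteq> Delta_longer (l + 1 / real (Suc n))"
        by (intro Delta_longer_antimono) (simp add: frac_le)
    qed
  qed
  also have "(\<Union>n. Delta_longer (l + 1 / real (Suc n))) = Delta_longer l"
  proof (intro equalityI subsetI)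
    fix q assume "q \<in> (\<Union>n. Delta_longer (l + 1 / real (Suc n)))"
    then obtain n where "q \<in> Delta_longer (l + 1 / real (Suc n))" by blast
    then show "q \<in> Delta_longer l"
      using Delta_longer_antimono[of l "l + 1 / real (Suc n)"] by auto
  next
    fix q assume "q \<in> Delta_longer l"
    then have q: "q \<in> Delta" "ereal l < snd q - fst q" by (simp_all add: mem_Delta_longer)
    obtain u where u: "l < u" "ereal u < snd q - fst q"
      using ereal_dense2[OF q(2)] by auto
    obtain n where "1 / real (Suc n) < u - l"
      using nat_approx_posE[of "u - l"] u by auto
    then have "ereal (l + 1 / real (Suc n)) < snd q - fst q"
      using u(2) by (intro less_trans[OF _ u(2)]) simp
    then show "q \<in> (\<Union>n. Delta_longer (l + 1 / real (Suc n)))"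
      using q(1) by (auto simp: mem_Delta_longer)
  qed
  finally show ?thesis .
qed


section \<open>Distributions without atoms\<close>

locale atomless_distribution = real_distribution +
  assumes no_atoms: "measure M {x} = 0"
begin

abbreviation "F \<equiv> cdf M"

lemma isCont_F: "isCont F x"
  by (simp add: isCont_cdf no_atoms)

lemma continuous_on_F: "continuous_on A F"
  by (simp add: continuous_at_imp_continuous_on isCont_F)

lemma F_measurable[measurable]: "F \<in> borel_measurable borel"
  by (rule borel_measurable_continuous_onI[OF continuous_on_F])

lemma F_mono: "x \<le> y \<Longrightarrow> F x \<le> F y"
  by (rule cdf_nondecreasing)

lemma prob_greater: "prob {x<..} = 1 - F x"
proof -
  have "{x<..} = space M - {..x}" by auto
  then show ?thesis using prob_compl[of "{..x}"] by (simp add: cdf_def)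
qed

lemma prob_Icc:
  assumes "x \<le> y"
  shows "prob {x..y} = F y - F x"
proof -
  have "{x..y} = {x} \<union> {x<..y}" using assms by auto
  then have "prob {x..y} = prob {x} + prob {x<..y}"
    by (simp only:) (rule finite_measure_Union, auto)
  then show ?thesis using cdf_diff_eq[of x y] assms no_atoms
    by (cases "x = y") (auto simp: le_less)
qed

text \<open>
  Intermediate value theorem; without atoms, \<open>F\<close> is continuous.
\<close>

lemma F_attains:
  assumes "0 < u" "u < 1"
  obtains v where "F v = u"
proof -
  have "eventually (\<lambda>x. F x < u) at_bot" "eventually (\<lambda>x. F x > u) at_top"
    using order_tendstoD[OF cdf_lim_at_bot] order_tendstoD[OF cdf_lim_at_top_prob] assms by auto
  then obtain a b where a: "\<And>x. x \<le> a \<Longrightarrow> F x < u" and b: "\<And>x. x \<ge> b \<Longrightarrow> F x > u"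
    by (auto simp: eventually_at_bot_linorder eventually_at_top_linorder)
  have "a \<le> b"
  proof (rule ccontr)
    assume "\<not> a \<le> b"
    then show False using a[of a] b[of a] by simp
  qed
  then have "\<exists>v. a \<le> v \<and> v \<le> b \<and> F v = u"
    using a[of a] b[of b] by (intro IVT) (auto simp: isCont_F)
  then show ?thesis using that by blast
qed

text \<open>
  If \<open>F v = u\<close>, then \<open>{..v}\<close> lies between \<open>{x. F x < u}\<close> and \<open>{x. F x \<le> u}\<close>. This gives both
  bounds up to an arbitrarily small change of \<open>u\<close>, also where \<open>F\<close> is constant on an interval.
\<close>

lemma prob_F_le:
  assumes "0 \<le> u" "u \<le> 1"
  shows "prob {x. F x \<le> u} = u"
proof -
  have meas: "{x. F x \<le> u} \<in> sets M" for u by simp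
  have lower: "u \<le> prob {x. F x \<le> u}" if u: "0 < u" "u < 1" for u
  proof -
    obtain v where v: "F v = u" using F_attains[OF u] .
    have "F v = prob {..v}" by (simp add: cdf_def)
    also have "\<dots> \<le> prob {x. F x \<le> u}"
      using F_mono by (intro finite_measure_mono meas) (auto simp flip: v)
    finally show ?thesis using v by simp
  qed
  have upper: "prob {x. F x \<le> u} \<le> w" if u: "u < w" "0 < w" "w < 1" for u w
  proof -
    obtain v where v: "F v = w" using F_attains[OF u(2,3)] .
    have "x \<le> v" if "F x \<le> u" for x
      using F_mono[of v x] that v u(1) by (rule_tac ccontr) auto
    then have "prob {x. F x \<le> u} \<le> prob {..v}"
      by (intro finite_measure_mono) auto
    then show ?thesis using v by (simp add: cdf_def)
  qed
  have "u \<le> prob {x. F x \<le> u}"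
  proof (cases "0 < u \<and> u < 1")
    case False
    then consider "u = 0" | "u = 1" using assms by linarith
    then show ?thesis
    proof cases
      case 2
      have "{x. F x \<le> u} = space M" using cdf_bounded_prob 2 by auto
      then show ?thesis using prob_space 2 by simp
    qed simp
  qed (use lower in simp)
  moreover have "prob {x. F x \<le> u} \<le> u"
  proof (cases "u < 1")
    case True
    show ?thesis
    proof (rule field_le_epsilon)
      fix e :: real assume "0 < e"
      \<comment> \<open>The second bound keeps the argument below 1, where \<open>F\<close> attains every value.\<close>
      then have "prob {x. F x \<le> u} \<le> min (u + e) ((u + 1) / 2)"
        using True assms by (intro upper) (auto simp: min_def)
      then show "prob {x. F x \<le> u} \<le> u + e" by simp
    qed
  qed (use assms in \<open>simp add: order_trans[OF prob_le_1]\<close>)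
  ultimately show ?thesis by simp
qed

lemma AE_F_pos: "AE x in M. 0 < F x"
proof (rule AE_I')
  have "prob {x. F x \<le> 0} = 0" using prob_F_le[of 0] by simp
  then show "{x. F x \<le> 0} \<in> null_sets M" by (auto simp: null_sets_def emeasure_eq_measure)
qed (auto simp: not_less)

lemma F_uniform: "distributed M lborel F (\<lambda>x. indicator {0..1 :: real} x / measure lborel {0..1 :: real})"
  unfolding uniform_distributed_iff using prob_F_le by simp

text \<open>
  Mean and variance of the uniform distribution give the second moment; the integrand is
  \<open>(F x - 1 / 2)\<^sup>2 + (3 / 4 - F x)\<close>.
\<close>

lemma integral_complement_squared: "(\<integral>x. (1 - F x)\<^sup>2 \<partial>M) = 1 / 3"
proof -
  have mean: "expectation F = 1 / 2"
    using uniform_distributed_expectation[OF F_uniform] by simp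
  have var: "(\<integral>x. (F x - 1 / 2)\<^sup>2 \<partial>M) = 1 / 12"
    using uniform_distributed_variance[OF F_uniform] by (simp add: mean)
  have bounded: "\<bar>F x\<bar> \<le> 1" for x
    using cdf_bounded_prob cdf_nonneg[of x] by simp
  have int_F: "integrable M F"
    by (rule integrable_const_bound[of _ 1]) (simp_all add: bounded)
  have int_sq: "integrable M (\<lambda>x. (F x - 1 / 2)\<^sup>2)"
  proof (rule integrable_const_bound[of _ 1])
    have "(F x - 1 / 2)\<^sup>2 \<le> 1" for x
      using bounded[of x] cdf_nonneg[of x] by (intro abs_square_le_1[THEN iffD2]) (auto simp: abs_le_iff)
    then show "AE x in M. norm ((F x - 1 / 2)\<^sup>2) \<le> 1" by simp
  qed simp
  have "(\<integral>x. (1 - F x)\<^sup>2 \<partial>M) = (\<integral>x. (F x - 1 / 2)\<^sup>2 + (3 / 4 - F x) \<partial>M)"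
    by (rule Bochner_Integration.integral_cong) (auto simp: power2_eq_square field_simps)
  also have "\<dots> = 1 / 12 + (3 / 4 - 1 / 2)"
    using int_F int_sq prob_space by (simp add: var mean)
  finally show ?thesis by simp
qed

end


section \<open>One-sided survival of a level\<close>

text \<open>
  Along the indices \<open>ks\<close>, read away from a vertex of value \<open>y\<close>, no value below \<open>y\<close> is reached before
  a value above \<open>y + l\<close>. Running out of indices counts as success, as the values beyond the sequence are
  infinite.
\<close>

fun survives :: "real \<Rightarrow> real \<Rightarrow> nat list \<Rightarrow> (nat \<Rightarrow> real) \<Rightarrow> bool" where
  "survives l y [] x = True"
| "survives l y (k # ks) x = (y + l < x k \<or> y \<le> x k \<and> survives l y ks x)"

lemma survives_iff:
  assumes "0 \<le> l"
  shows "survives l y ks x \<longleftrightarrow>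
    \<not> (\<exists>m<length ks. x (ks ! m) < y \<and> (\<forall>m'\<le>m. x (ks ! m') \<le> y + l))"
proof (induction ks)
  case (Cons k ks)
  define fails where "fails = (\<exists>m<length ks. x (ks ! m) < y \<and> (\<forall>m'\<le>m. x (ks ! m') \<le> y + l))"
  have le_Suc: "(\<forall>m'\<le>Suc m. P m') \<longleftrightarrow> P 0 \<and> (\<forall>m'\<le>m. P (Suc m'))" for P m
    unfolding less_Suc_eq_le[symmetric] by (rule All_less_Suc2)
  have "(\<exists>m<length (k # ks). x ((k # ks) ! m) < y \<and> (\<forall>m'\<le>m. x ((k # ks) ! m') \<le> y + l)) \<longleftrightarrow>
      x k < y \<and> x k \<le> y + l \<or> x k \<le> y + l \<and> fails"
    unfolding fails_def length_Cons Ex_less_Suc2 le_Suc nth_Cons_0 nth_Cons_Suc by auto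
  moreover have "survives l y ks x \<longleftrightarrow> \<not> fails" using Cons.IH by (simp only: fails_def)
  ultimately show ?case using assms by auto
qed simp

lemma survives_cong:
  assumes "\<And>k. k \<in> set ks \<Longrightarrow> x k = x' k"
  shows "survives l y ks x = survives l y ks x'"
  using assms by (induction ks) auto

lemma survives_measurable:
  assumes N: "sets N = sets (borel :: real measure)"
    and "set ks \<subseteq> I" "y \<in> borel_measurable (PiM I (\<lambda>_. N))"
  shows "Measurable.pred (PiM I (\<lambda>_. N)) (\<lambda>x. survives l (y x) ks x)"
  using assms(2,3)
proof (induction ks)
  case (Cons k ks)
  note [measurable] = Cons.prems(2)
  have "(\<lambda>x. x k) \<in> measurable (PiM I (\<lambda>_. N)) N"
    using Cons.prems by (intro measurable_component_singleton) simp
  then have [measurable]: "(\<lambda>x. x k) \<in> borel_measurable (PiM I (\<lambda>_. N))"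
    by (simp only: measurable_cong_sets[OF refl N])
  have "Measurable.pred (PiM I (\<lambda>_. N)) (\<lambda>x. y x + l < x k)"
    "Measurable.pred (PiM I (\<lambda>_. N)) (\<lambda>x. y x \<le> x k)"
    unfolding pred_def by (intro borel_measurable_less borel_measurable_le; measurable)+
  moreover have "Measurable.pred (PiM I (\<lambda>_. N)) (\<lambda>x. survives l (y x) ks x)"
    using Cons by simp
  ultimately show ?case unfolding survives.simps by (intro pred_intros_logic)
qed simp

text \<open>
  The probability of success in a walk of at most \<open>m\<close> independent steps, where a step ends the walk
  successfully with probability \<open>p\<close>, lets it go on with probability \<open>q\<close>, and makes it fail otherwise.
\<close>

fun escape :: "real \<Rightarrow> real \<Rightarrow> nat \<Rightarrow> real" where
  "escape p q 0 = 1"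
| "escape p q (Suc m) = p + q * escape p q m"

lemma escape_closed_form:
  fixes p q :: real
  assumes "q < 1"
  defines "r \<equiv> p / (1 - q)"
  shows "escape p q m = r + (1 - r) * q ^ m"
proof (induction m)
  case (Suc m)
  have "r * (1 - q) = p" using assms by simp
  then have "p = r - q * r" by (simp add: algebra_simps)
  then have "p + q * (r + (1 - r) * q ^ m) = r + (1 - r) * q ^ Suc m" by (simp add: algebra_simps)
  then show ?case using Suc by simp
qed simp

lemma escape_nonneg: "0 \<le> p \<Longrightarrow> 0 \<le> q \<Longrightarrow> 0 \<le> escape p q m"
  by (induction m) auto

lemma escape_le_1:
  assumes "0 \<le> p" "0 \<le> q" "p + q \<le> 1"
  shows "escape p q m \<le> 1"
proof (induction m)
  case (Suc m)
  then have "q * escape p q m \<le> q * 1" using assms by (intro mult_left_mono)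
  then show ?case using assms by simp
qed simp

text \<open>
  Each factor converges geometrically to \<open>p / (1 - q)\<close>, so the product at \<open>i\<close> differs from the limit
  by at most \<open>q ^ i + q ^ (n - Suc i)\<close>. The sum of these errors is bounded in \<open>n\<close>.
\<close>

lemma escape_average_tendsto:
  assumes p: "0 \<le> p" and q: "0 \<le> q" "q < 1" and pq: "p + q \<le> 1"
  shows "(\<lambda>n. (\<Sum>i<n. escape p q i * escape p q (n - Suc i)) / real n) \<longlonglongrightarrow> (p / (1 - q))\<^sup>2"
proof -
  define r where "r = p / (1 - q)"
  have r: "0 \<le> r" "r \<le> 1" using p q pq by (auto simp: r_def)
  have esc: "0 \<le> escape p q m - r" "escape p q m - r \<le> q ^ m" for m
  proof -
    have e: "escape p q m - r = (1 - r) * q ^ m" using escape_closed_form[OF q(2), of p m] by (simp add: r_def)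
    show "0 \<le> escape p q m - r" unfolding e using r q by simp
    show "escape p q m - r \<le> q ^ m" unfolding e using r q mult_right_mono[of "1 - r" 1 "q ^ m"] by simp
  qed
  have geom: "(\<Sum>i<n. q ^ i) \<le> 1 / (1 - q)" for n
    using q by (simp add: sum_gp_strict divide_right_mono)
  have dev: "\<bar>escape p q i * escape p q j - r\<^sup>2\<bar> \<le> q ^ i + q ^ j" for i j
  proof -
    have "escape p q i * escape p q j - r\<^sup>2 = escape p q i * (escape p q j - r) + r * (escape p q i - r)"
      by (simp add: algebra_simps power2_eq_square)
    moreover have "escape p q i * (escape p q j - r) \<le> 1 * q ^ j"
      using esc escape_le_1[OF p q(1) pq] by (intro mult_mono) auto
    moreover have "r * (escape p q i - r) \<le> 1 * q ^ i"
      using esc r by (intro mult_mono) auto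
    moreover have "0 \<le> escape p q i * (escape p q j - r)" "0 \<le> r * (escape p q i - r)"
      using esc r escape_nonneg[OF p q(1)] by simp_all
    ultimately show ?thesis by simp
  qed
  have "norm ((\<Sum>i<n. escape p q i * escape p q (n - Suc i)) / real n - r\<^sup>2) \<le> 2 / (1 - q) * (1 / real n)"
    if "0 < n" for n
  proof -
    have "(\<Sum>i<n. escape p q i * escape p q (n - Suc i)) / real n - r\<^sup>2 =
        (\<Sum>i<n. escape p q i * escape p q (n - Suc i) - r\<^sup>2) / real n"
      using that by (simp add: sum_subtractf diff_divide_distrib)
    moreover have "\<bar>\<Sum>i<n. escape p q i * escape p q (n - Suc i) - r\<^sup>2\<bar> \<le> (\<Sum>i<n. q ^ i + q ^ (n - Suc i))"
      by (intro order_trans[OF sum_abs] sum_mono dev)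
    moreover have "(\<Sum>i<n. q ^ i + q ^ (n - Suc i)) \<le> 2 / (1 - q)"
      using geom[of n] sum.nat_diff_reindex[of "\<lambda>i. q ^ i" n] by (simp add: sum.distrib)
    ultimately show ?thesis
      using divide_right_mono[of "\<bar>\<Sum>i<n. escape p q i * escape p q (n - Suc i) - r\<^sup>2\<bar>" "2 / (1 - q)" "real n"]
      by simp
  qed
  then have "eventually (\<lambda>n. norm ((\<Sum>i<n. escape p q i * escape p q (n - Suc i)) / real n - r\<^sup>2)
      \<le> 2 / (1 - q) * (1 / real n)) sequentially"
    by (intro eventually_sequentiallyI[of 1]) simp
  moreover have "(\<lambda>n. 2 / (1 - q) * (1 / real n)) \<longlonglongrightarrow> 0"
    using lim_const_over_n[of "2 / (1 - q)"] by simp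
  ultimately have "(\<lambda>n. (\<Sum>i<n. escape p q i * escape p q (n - Suc i)) / real n - r\<^sup>2) \<longlonglongrightarrow> 0"
    by (rule Lim_null_comparison)
  then show ?thesis by (simp only: LIM_zero_iff r_def)
qed

context atomless_distribution
begin

abbreviation jump_prob :: "real \<Rightarrow> real \<Rightarrow> real" where
  "jump_prob l y \<equiv> 1 - F (y + l)"

abbreviation stay_prob :: "real \<Rightarrow> real \<Rightarrow> real" where
  "stay_prob l y \<equiv> F (y + l) - F y"

text \<open>
  Integrating out the first coordinate of the walk. The factor \<open>H\<close> stands for the walk on the other
  side, which does not look at this coordinate.
\<close>

lemma nn_integral_survives_step:
  fixes H :: "(nat \<Rightarrow> real) \<Rightarrow> ennreal"
  assumes l: "0 \<le> l" and I: "finite I" "k \<in> I" and ks: "set ks \<subseteq> I - {k}"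
    and H: "\<And>J. J \<in> {I, I - {k}} \<Longrightarrow> H \<in> borel_measurable (PiM J (\<lambda>_. M))" "\<And>x z. H (x(k := z)) = H x"
  shows "(\<integral>\<^sup>+x. of_bool (survives l y (k # ks) x) * H x \<partial>PiM I (\<lambda>_. M)) =
    ennreal (jump_prob l y) * (\<integral>\<^sup>+x. H x \<partial>PiM (I - {k}) (\<lambda>_. M)) +
    ennreal (stay_prob l y) * (\<integral>\<^sup>+x. of_bool (survives l y ks x) * H x \<partial>PiM (I - {k}) (\<lambda>_. M))"
proof -
  interpret P: product_sigma_finite "\<lambda>_. M" by standard
  define J where "J = I - {k}"
  have I_eq: "I = insert k J" and J: "finite J" "k \<notin> J" using I by (auto simp: J_def)
  have [measurable]: "H \<in> borel_measurable (PiM I (\<lambda>_. M))" "H \<in> borel_measurable (PiM J (\<lambda>_. M))"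
    using H by (simp_all add: J_def)
  have [measurable]: "Measurable.pred (PiM I (\<lambda>_. M)) (survives l y (k # ks))"
    by (rule survives_measurable[OF events_eq_borel, where y = "\<lambda>_. y"]) (use ks I in auto)
  have [measurable]: "Measurable.pred (PiM J (\<lambda>_. M)) (survives l y ks)"
    by (rule survives_measurable[OF events_eq_borel, where y = "\<lambda>_. y"]) (use ks in \<open>auto simp: J_def\<close>)
  have meas: "(\<lambda>x. of_bool (survives l y (k # ks) x) * H x) \<in> borel_measurable (PiM I (\<lambda>_. M))"
    by measurable
  have "(\<integral>\<^sup>+x. of_bool (survives l y (k # ks) x) * H x \<partial>PiM I (\<lambda>_. M)) =
      (\<integral>\<^sup>+x. \<integral>\<^sup>+z. of_bool (survives l y (k # ks) (x(k := z))) * H (x(k := z)) \<partial>M \<partial>PiM J (\<lambda>_. M))"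
    using meas unfolding I_eq by (rule P.product_nn_integral_insert[OF J])
  also have "\<dots> = (\<integral>\<^sup>+x. ennreal (jump_prob l y) * H x +
      ennreal (stay_prob l y) * (of_bool (survives l y ks x) * H x) \<partial>PiM J (\<lambda>_. M))"
  proof (rule nn_integral_cong)
    fix x
    have "survives l y ks (x(k := z)) = survives l y ks x" for z
      using ks by (intro survives_cong) auto
    then have "(\<integral>\<^sup>+z. of_bool (survives l y (k # ks) (x(k := z))) * H (x(k := z)) \<partial>M) =
        (\<integral>\<^sup>+z. H x * indicator {y + l<..} z + (of_bool (survives l y ks x) * H x) * indicator {y..y + l} z \<partial>M)"
      using l by (intro nn_integral_cong) (auto simp: H(2) indicator_def)
    also have "\<dots> = H x * emeasure M {y + l<..} + (of_bool (survives l y ks x) * H x) * emeasure M {y..y + l}"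
      by (subst nn_integral_add) (simp_all add: nn_integral_cmult_indicator)
    also have "\<dots> = ennreal (jump_prob l y) * H x + ennreal (stay_prob l y) * (of_bool (survives l y ks x) * H x)"
      using l by (simp add: emeasure_eq_measure prob_greater prob_Icc mult.commute)
    finally show "(\<integral>\<^sup>+z. of_bool (survives l y (k # ks) (x(k := z))) * H (x(k := z)) \<partial>M) = \<dots>" .
  qed
  also have "\<dots> = ennreal (jump_prob l y) * (\<integral>\<^sup>+x. H x \<partial>PiM J (\<lambda>_. M)) +
      ennreal (stay_prob l y) * (\<integral>\<^sup>+x. of_bool (survives l y ks x) * H x \<partial>PiM J (\<lambda>_. M))"
    by (simp add: nn_integral_add nn_integral_cmult)
  finally show ?thesis by (simp only: J_def)
qed

abbreviation survival_prob :: "real \<Rightarrow> real \<Rightarrow> nat \<Rightarrow> real" where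
  "survival_prob l y \<equiv> escape (jump_prob l y) (stay_prob l y)"

lemma F_le_1: "F x \<le> 1"
  by (rule cdf_bounded_prob)

lemma survival_prob_nonneg: "0 \<le> l \<Longrightarrow> 0 \<le> survival_prob l y m"
  by (intro escape_nonneg) (simp_all add: F_le_1 F_mono)

lemma survival_prob_Suc:
  assumes "0 \<le> l"
  shows "ennreal (survival_prob l y (Suc m)) =
    ennreal (jump_prob l y) + ennreal (stay_prob l y) * ennreal (survival_prob l y m)"
  using assms survival_prob_nonneg[OF assms, of y m]
  by (simp add: F_le_1 F_mono ennreal_plus ennreal_mult)

text \<open>
  The index set may be larger than the set of indices of the walk: after the first success, the
  remaining indices are irrelevant but still present in the product.
\<close>

lemma nn_integral_survives:
  assumes l: "0 \<le> l" and I: "finite I" "set js \<subseteq> I" "distinct js"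
  shows "(\<integral>\<^sup>+x. of_bool (survives l y js x) \<partial>PiM I (\<lambda>_. M)) = ennreal (survival_prob l y (length js))"
  using I
proof (induction js arbitrary: I)
  case Nil
  interpret P: prob_space "PiM I (\<lambda>_. M)" by (intro prob_space_PiM prob_space_axioms)
  show ?case by (simp add: P.emeasure_space_1)
next
  case (Cons k ks)
  interpret P: prob_space "PiM (I - {k}) (\<lambda>_. M)" by (intro prob_space_PiM prob_space_axioms)
  have "(\<integral>\<^sup>+x. of_bool (survives l y (k # ks) x) * 1 \<partial>PiM I (\<lambda>_. M)) =
    ennreal (jump_prob l y) * (\<integral>\<^sup>+x. 1 \<partial>PiM (I - {k}) (\<lambda>_. M)) +
    ennreal (stay_prob l y) * (\<integral>\<^sup>+x. of_bool (survives l y ks x) * 1 \<partial>PiM (I - {k}) (\<lambda>_. M))"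
    using Cons.prems by (intro nn_integral_survives_step l) auto
  moreover have "(\<integral>\<^sup>+x. of_bool (survives l y ks x) \<partial>PiM (I - {k}) (\<lambda>_. M)) =
      ennreal (survival_prob l y (length ks))"
    using Cons.prems by (intro Cons.IH) auto
  ultimately show ?case
    unfolding list.size(4) add_Suc_right Nat.add_0_right survival_prob_Suc[OF l]
    by (simp del: survives.simps add: P.emeasure_space_1)
qed

lemma nn_integral_survives_both:
  assumes l: "0 \<le> l" and I: "finite I" "set ks \<union> set js \<subseteq> I" "distinct (ks @ js)"
  shows "(\<integral>\<^sup>+x. of_bool (survives l y ks x) * of_bool (survives l y js x) \<partial>PiM I (\<lambda>_. M)) =
    ennreal (survival_prob l y (length ks)) * ennreal (survival_prob l y (length js))"
  using I
proof (induction ks arbitrary: I)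
  case Nil
  then show ?case using nn_integral_survives[OF l, of I js y] by simp
next
  case (Cons k ks)
  have "(\<integral>\<^sup>+x. of_bool (survives l y (k # ks) x) * of_bool (survives l y js x) \<partial>PiM I (\<lambda>_. M)) =
    ennreal (jump_prob l y) * (\<integral>\<^sup>+x. of_bool (survives l y js x) \<partial>PiM (I - {k}) (\<lambda>_. M)) +
    ennreal (stay_prob l y) * (\<integral>\<^sup>+x. of_bool (survives l y ks x) * of_bool (survives l y js x)
      \<partial>PiM (I - {k}) (\<lambda>_. M))"
  proof (rule nn_integral_survives_step[OF l])
    fix J assume "J \<in> {I, I - {k}}"
    then have "set js \<subseteq> J" using Cons.prems by auto
    then have [measurable]: "Measurable.pred (PiM J (\<lambda>_. M)) (survives l y js)"
      using survives_measurable[OF events_eq_borel, of js J "\<lambda>_. y" l] by simp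
    show "(\<lambda>x. of_bool (survives l y js x) :: ennreal) \<in> borel_measurable (PiM J (\<lambda>_. M))"
      by measurable
  next
    fix x z
    show "(of_bool (survives l y js (x(k := z))) :: ennreal) = of_bool (survives l y js x)"
    proof -
      have "survives l y js (x(k := z)) = survives l y js x"
        using Cons.prems by (intro survives_cong) auto
      then show ?thesis by (simp only:)
    qed
  qed (use Cons.prems in auto)
  moreover have "(\<integral>\<^sup>+x. of_bool (survives l y ks x) * of_bool (survives l y js x) \<partial>PiM (I - {k}) (\<lambda>_. M)) =
      ennreal (survival_prob l y (length ks)) * ennreal (survival_prob l y (length js))"
    using Cons.prems by (intro Cons.IH) auto
  moreover have "(\<integral>\<^sup>+x. of_bool (survives l y js x) \<partial>PiM (I - {k}) (\<lambda>_. M)) =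
      ennreal (survival_prob l y (length js))"
    using Cons.prems by (intro nn_integral_survives[OF l]) auto
  ultimately show ?case
    by (simp only: list.size(4) add_Suc_right Nat.add_0_right survival_prob_Suc[OF l] distrib_right mult.assoc)
qed

end


section \<open>The probability that an index persists\<close>

lemma survives_iff_enumeration:
  assumes l: "0 \<le> l" and len: "length ks = N" and nth: "\<And>m. m < N \<Longrightarrow> ks ! m = f m"
  shows "survives l y ks x \<longleftrightarrow> \<not> (\<exists>m<N. x (f m) < y \<and> (\<forall>m'\<le>m. x (f m') \<le> y + l))"
proof -
  have "x (ks ! m) < y \<and> (\<forall>m'\<le>m. x (ks ! m') \<le> y + l) \<longleftrightarrow>
      x (f m) < y \<and> (\<forall>m'\<le>m. x (f m') \<le> y + l)" if "m < N" for m
    using nth that by auto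
  then show ?thesis unfolding survives_iff[OF l] len by blast
qed

text \<open>
  The vertices between \<open>i\<close> and \<open>j\<close> are those that a walk from \<open>i\<close> passes on its way to \<open>j\<close>; the
  walk to the left reads the indices in decreasing order.
\<close>

lemma persists_iff_survives:
  assumes l: "0 \<le> l" and i: "i \<in> {1..n}"
  shows "persists n x l i \<longleftrightarrow>
    survives l (x i) (rev [1..<i]) x \<and> survives l (x i) [Suc i..<Suc n] x"
proof -
  define right where "right = (\<exists>j\<in>{i<..n}. x j < x i \<and> (\<forall>k\<in>{i..j}. x k \<le> x i + l))"
  define left where "left = (\<exists>j\<in>{1..<i}. x j < x i \<and> (\<forall>k\<in>{j..i}. x k \<le> x i + l))"
  have "survives l (x i) [Suc i..<Suc n] x \<longleftrightarrow> \<not> right"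
  proof -
    have "(\<exists>m<n - i. x (Suc i + m) < x i \<and> (\<forall>m'\<le>m. x (Suc i + m') \<le> x i + l)) \<longleftrightarrow> right"
    proof
      assume "\<exists>m<n - i. x (Suc i + m) < x i \<and> (\<forall>m'\<le>m. x (Suc i + m') \<le> x i + l)"
      then obtain m where m: "m < n - i" "x (Suc i + m) < x i"
        and below: "\<And>m'. m' \<le> m \<Longrightarrow> x (Suc i + m') \<le> x i + l" by blast
      have "x k \<le> x i + l" if "k \<in> {i..Suc i + m}" for k
        using below[of "k - Suc i"] that l by (cases "k = i") auto
      then show right unfolding right_def using m by (intro bexI[of _ "Suc i + m"]) auto
    next
      assume right
      then obtain j where j: "i < j" "j \<le> n" "x j < x i" and below: "\<And>k. k \<in> {i..j} \<Longrightarrow> x k \<le> x i + l"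
        unfolding right_def by auto
      then show "\<exists>m<n - i. x (Suc i + m) < x i \<and> (\<forall>m'\<le>m. x (Suc i + m') \<le> x i + l)"
        by (intro exI[of _ "j - Suc i"]) auto
    qed
    moreover have "[Suc i..<Suc n] ! m = Suc i + m" if "m < n - i" for m
      using that by (subst nth_upt) auto
    then have "survives l (x i) [Suc i..<Suc n] x \<longleftrightarrow>
        \<not> (\<exists>m<n - i. x (Suc i + m) < x i \<and> (\<forall>m'\<le>m. x (Suc i + m') \<le> x i + l))"
      by (intro survives_iff_enumeration[OF l]) (simp_all only: length_upt diff_Suc_Suc)
    ultimately show ?thesis by (simp only:)
  qed
  moreover have "survives l (x i) (rev [1..<i]) x \<longleftrightarrow> \<not> left"
  proof -
    have "(\<exists>m<i - 1. x (i - Suc m) < x i \<and> (\<forall>m'\<le>m. x (i - Suc m') \<le> x i + l)) \<longleftrightarrow> left"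
    proof
      assume "\<exists>m<i - 1. x (i - Suc m) < x i \<and> (\<forall>m'\<le>m. x (i - Suc m') \<le> x i + l)"
      then obtain m where m: "m < i - 1" "x (i - Suc m) < x i"
        and below: "\<And>m'. m' \<le> m \<Longrightarrow> x (i - Suc m') \<le> x i + l" by blast
      have "x k \<le> x i + l" if "k \<in> {i - Suc m..i}" for k
        using below[of "i - Suc k"] that l m by (cases "k = i") auto
      then show left unfolding left_def using m by (intro bexI[of _ "i - Suc m"]) auto
    next
      assume left
      then obtain j where j: "1 \<le> j" "j < i" "x j < x i" and below: "\<And>k. k \<in> {j..i} \<Longrightarrow> x k \<le> x i + l"
        unfolding left_def by auto
      then show "\<exists>m<i - 1. x (i - Suc m) < x i \<and> (\<forall>m'\<le>m. x (i - Suc m') \<le> x i + l)"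
        by (intro exI[of _ "i - Suc j"]) auto
    qed
    moreover have "rev [1..<i] ! m = i - Suc m" if "m < i - 1" for m
      using that by (simp add: rev_nth)
    then have "survives l (x i) (rev [1..<i]) x \<longleftrightarrow>
        \<not> (\<exists>m<i - 1. x (i - Suc m) < x i \<and> (\<forall>m'\<le>m. x (i - Suc m') \<le> x i + l))"
      by (intro survives_iff_enumeration[OF l]) (simp_all only: length_rev length_upt)
    ultimately show ?thesis by (simp only:)
  qed
  moreover have "merges_below n x (x i + l) i \<longleftrightarrow> left \<or> right"
  proof
    assume "merges_below n x (x i + l) i"
    then obtain j where j: "j \<in> {1..n}" "x j < x i" "\<forall>k\<in>{min i j..max i j}. x k \<le> x i + l"
      unfolding merges_below_def by blast
    then have "j \<noteq> i" by auto
    then consider "j < i" | "i < j" by linarith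
    then show "left \<or> right"
    proof cases
      case 1
      then have left unfolding left_def using j by (intro bexI[of _ j]) auto
      then show ?thesis ..
    next
      case 2
      then have right unfolding right_def using j by (intro bexI[of _ j]) auto
      then show ?thesis ..
    qed
  next
    assume "left \<or> right"
    then show "merges_below n x (x i + l) i"
    proof
      assume left
      then obtain j where "j \<in> {1..<i}" "x j < x i" "\<forall>k\<in>{j..i}. x k \<le> x i + l"
        unfolding left_def by blast
      then show ?thesis unfolding merges_below_def using i by (intro bexI[of _ j]) auto
    next
      assume right
      then obtain j where "j \<in> {i<..n}" "x j < x i" "\<forall>k\<in>{i..j}. x k \<le> x i + l"
        unfolding right_def by blast
      then show ?thesis unfolding merges_below_def using i by (intro bexI[of _ j]) auto
    qed
  qed
  ultimately show ?thesis by (simp add: persists_def)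
qed

context atomless_distribution
begin

lemma persists_measurable:
  assumes "0 \<le> l" "i \<in> {1..n}"
  shows "Measurable.pred (PiM {1..n} (\<lambda>_. M)) (\<lambda>x. persists n x l i)"
proof -
  have "(\<lambda>x. x i) \<in> measurable (PiM {1..n} (\<lambda>_. M)) M"
    using assms by (intro measurable_component_singleton) simp
  then have "(\<lambda>x. x i) \<in> borel_measurable (PiM {1..n} (\<lambda>_. M))"
    by (simp only: measurable_cong_sets[OF refl events_eq_borel])
  then show ?thesis
    unfolding persists_iff_survives[OF assms]
    using assms by (intro pred_intros_logic survives_measurable[OF events_eq_borel]) auto
qed

lemma survival_prob_measurable [measurable]: "(\<lambda>y. survival_prob l y m) \<in> borel_measurable borel"
  by (induction m) simp_all

lemma survival_prob_le_1: "0 \<le> l \<Longrightarrow> survival_prob l y m \<le> 1"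
  by (intro escape_le_1) (simp_all add: F_le_1 F_mono cdf_nonneg)

text \<open>
  The coordinate \<open>i\<close> is integrated last: for a fixed value of it, the walks to the two sides depend on
  disjoint sets of coordinates.
\<close>

lemma prob_persists:
  assumes l: "0 \<le> l" and i: "i \<in> {1..n}"
  shows "measure (PiM {1..n} (\<lambda>_. M)) {x \<in> space (PiM {1..n} (\<lambda>_. M)). persists n x l i} =
    (\<integral>y. survival_prob l y (i - 1) * survival_prob l y (n - i) \<partial>M)"
proof -
  interpret P: product_sigma_finite "\<lambda>_. M" by standard
  define J where "J = {1..n} - {i}"
  have I_eq: "{1..n} = insert i J" and J: "finite J" "i \<notin> J" using i by (auto simp: J_def)
  let ?Q = "{x \<in> space (PiM {1..n} (\<lambda>_. M)). persists n x l i}"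
  note [measurable] = persists_measurable[OF l i]
  have "emeasure (PiM {1..n} (\<lambda>_. M)) ?Q = (\<integral>\<^sup>+x. indicator ?Q x \<partial>PiM {1..n} (\<lambda>_. M))"
    by (rule nn_integral_indicator[symmetric]) measurable
  also have "\<dots> = (\<integral>\<^sup>+x. of_bool (persists n x l i) \<partial>PiM {1..n} (\<lambda>_. M))"
    by (intro nn_integral_cong) (simp add: indicator_def)
  also have "\<dots> = (\<integral>\<^sup>+y. \<integral>\<^sup>+x. of_bool (persists n (x(i := y)) l i) \<partial>PiM J (\<lambda>_. M) \<partial>M)"
  proof -
    have "(\<lambda>x. of_bool (persists n x l i) :: ennreal) \<in> borel_measurable (PiM {1..n} (\<lambda>_. M))"
      by measurable
    then show ?thesis unfolding I_eq by (rule P.product_nn_integral_insert_rev[OF J])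
  qed
  also have "\<dots> = (\<integral>\<^sup>+y. \<integral>\<^sup>+x. of_bool (survives l y (rev [1..<i]) x) *
      of_bool (survives l y [Suc i..<Suc n] x) \<partial>PiM J (\<lambda>_. M) \<partial>M)"
  proof (intro nn_integral_cong)
    fix x y
    have "survives l y (rev [1..<i]) (x(i := y)) = survives l y (rev [1..<i]) x"
      "survives l y [Suc i..<Suc n] (x(i := y)) = survives l y [Suc i..<Suc n] x"
      by (intro survives_cong; auto)+
    then show "of_bool (persists n (x(i := y)) l i) = (of_bool (survives l y (rev [1..<i]) x) *
        of_bool (survives l y [Suc i..<Suc n] x) :: ennreal)"
      unfolding persists_iff_survives[OF l i] fun_upd_same by simp
  qed
  also have "\<dots> = (\<integral>\<^sup>+y. ennreal (survival_prob l y (i - 1) * survival_prob l y (n - i)) \<partial>M)"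
  proof (intro nn_integral_cong)
    fix y
    have "distinct (rev [1..<i] @ [Suc i..<Suc n])" by auto
    moreover have "set (rev [1..<i]) \<union> set [Suc i..<Suc n] \<subseteq> J" using i by (auto simp: J_def)
    ultimately show "(\<integral>\<^sup>+x. of_bool (survives l y (rev [1..<i]) x) *
      of_bool (survives l y [Suc i..<Suc n] x) \<partial>PiM J (\<lambda>_. M)) =
        ennreal (survival_prob l y (i - 1) * survival_prob l y (n - i))"
      using nn_integral_survives_both[OF l J(1), of "rev [1..<i]" "[Suc i..<Suc n]" y]
      by (simp only: length_rev length_upt diff_Suc_Suc ennreal_mult survival_prob_nonneg[OF l])
  qed
  also have "\<dots> = ennreal (\<integral>y. survival_prob l y (i - 1) * survival_prob l y (n - i) \<partial>M)"
  proof (rule nn_integral_eq_integral)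
    show "integrable M (\<lambda>y. survival_prob l y (i - 1) * survival_prob l y (n - i))"
      by (rule integrable_const_bound[of _ 1])
        (simp_all add: survival_prob_nonneg[OF l] survival_prob_le_1[OF l] abs_mult mult_le_one)
  qed (simp add: survival_prob_nonneg[OF l])
  finally show ?thesis
    by (simp add: measure_def survival_prob_nonneg[OF l] integral_nonneg)
qed

text \<open>
  The limit of the expected number of long points per index.
\<close>

definition long_fraction :: "real \<Rightarrow> real" where
  "long_fraction l = (\<integral>y. ((1 - F (y + l)) / (1 - F (y + l) + F y))\<^sup>2 \<partial>M)"

text \<open>
  For almost all \<open>y\<close>, \<open>F y\<close> is positive and hence \<open>stay_prob l y < 1\<close>, so the pointwise averages
  converge; they are bounded by 1.
\<close>

lemma survival_average_tendsto:
  assumes l: "0 \<le> l"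
  shows "(\<lambda>n. (\<integral>y. (\<Sum>i<n. survival_prob l y i * survival_prob l y (n - Suc i)) / real n \<partial>M))
    \<longlonglongrightarrow> long_fraction l"
  unfolding long_fraction_def
proof (rule integral_dominated_convergence[where w = "\<lambda>_. 1"])
  show "AE y in M. (\<lambda>n. (\<Sum>i<n. survival_prob l y i * survival_prob l y (n - Suc i)) / real n)
      \<longlonglongrightarrow> ((1 - F (y + l)) / (1 - F (y + l) + F y))\<^sup>2"
    using AE_F_pos
  proof eventually_elim
    case (elim y)
    have "1 - F (y + l) + F y = 1 - stay_prob l y" by simp
    then show ?case
      using elim l F_le_1[of "y + l"] F_mono[of y "y + l"]
      by (simp only:) (rule escape_average_tendsto, auto)
  qed
  show "AE y in M. norm ((\<Sum>i<n. survival_prob l y i * survival_prob l y (n - Suc i)) / real n) \<le> 1" for n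
  proof (rule AE_I2)
    fix y
    have "(\<Sum>i<n. survival_prob l y i * survival_prob l y (n - Suc i)) \<le> (\<Sum>i<n. 1)"
      by (intro sum_mono mult_le_one survival_prob_nonneg survival_prob_le_1 l)
    moreover have "0 \<le> (\<Sum>i<n. survival_prob l y i * survival_prob l y (n - Suc i))"
      by (intro sum_nonneg mult_nonneg_nonneg survival_prob_nonneg l)
    ultimately show "norm ((\<Sum>i<n. survival_prob l y i * survival_prob l y (n - Suc i)) / real n) \<le> 1"
      by (cases "n = 0") (simp_all add: divide_le_eq)
  qed
qed simp_all

lemma long_fraction_0: "long_fraction 0 = 1 / 3"
  by (simp add: long_fraction_def integral_complement_squared)

lemma long_fraction_right_continuous:
  assumes l: "0 \<le> l"
  shows "(\<lambda>n. long_fraction (l + 1 / real (Suc n))) \<longlonglongrightarrow> long_fraction l"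
  unfolding long_fraction_def
proof (rule integral_dominated_convergence[where w = "\<lambda>_. 1"])
  have conv: "(\<lambda>n. F (y + (l + 1 / real (Suc n)))) \<longlonglongrightarrow> F (y + l)" for y
  proof (rule isCont_tendsto_compose[OF isCont_F])
    have "(\<lambda>n. y + (l + 1 / real (Suc n))) \<longlonglongrightarrow> y + (l + 0)"
      by (intro tendsto_intros LIMSEQ_Suc lim_1_over_n)
    then show "(\<lambda>n. y + (l + 1 / real (Suc n))) \<longlonglongrightarrow> y + l" by simp
  qed
  show "AE y in M. (\<lambda>n. ((1 - F (y + (l + 1 / real (Suc n)))) / (1 - F (y + (l + 1 / real (Suc n))) + F y))\<^sup>2)
      \<longlonglongrightarrow> ((1 - F (y + l)) / (1 - F (y + l) + F y))\<^sup>2"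
    using AE_F_pos
  proof eventually_elim
    case (elim y)
    then show ?case
      using F_le_1[of "y + l"] by (intro tendsto_intros conv) auto
  qed
  show "AE y in M. norm (((1 - F (y + (l + 1 / real (Suc n)))) / (1 - F (y + (l + 1 / real (Suc n))) + F y))\<^sup>2) \<le> 1" for n
  proof (rule AE_I2)
    fix y
    have "0 \<le> 1 - F (y + (l + 1 / real (Suc n)))" "0 \<le> F y" using F_le_1 cdf_nonneg by simp_all
    then have "\<bar>(1 - F (y + (l + 1 / real (Suc n)))) / (1 - F (y + (l + 1 / real (Suc n))) + F y)\<bar> \<le> 1"
      by (simp add: abs_le_iff divide_le_eq)
    then show "norm (((1 - F (y + (l + 1 / real (Suc n)))) / (1 - F (y + (l + 1 / real (Suc n))) + F y))\<^sup>2) \<le> 1"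
      by (simp add: abs_square_le_1)
  qed
qed simp_all

end


section \<open>Independent identically distributed sequences\<close>

text \<open>
  The positive part of \<open>A n - c * B n\<close> is at most the distance from \<open>I n\<close> to \<open>c\<close>, so it tends to 0
  almost surely and, being bounded, also in expectation.
\<close>

lemma limit_comparison:
  fixes A B :: "nat \<Rightarrow> 'a \<Rightarrow> real"
  assumes M: "prob_space M"
    and A: "\<And>n. A n \<in> borel_measurable M" "\<And>n \<omega>. \<bar>A n \<omega>\<bar> \<le> 1"
    and B: "\<And>n. B n \<in> borel_measurable M" "\<And>n \<omega>. 0 \<le> B n \<omega>" "\<And>n \<omega>. B n \<omega> \<le> 1"
    and bound: "AE \<omega> in M. \<exists>I. I \<longlonglongrightarrow> c \<and> (\<forall>n\<ge>1. A n \<omega> \<le> I n * B n \<omega>)"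
    and lim_A: "(\<lambda>n. \<integral>\<omega>. A n \<omega> \<partial>M) \<longlonglongrightarrow> a"
    and lim_B: "(\<lambda>n. \<integral>\<omega>. B n \<omega> \<partial>M) \<longlonglongrightarrow> b"
  shows "a \<le> c * b"
proof -
  interpret prob_space M by fact
  note [measurable] = A(1) B(1)
  define h where "h n \<omega> = max 0 (A n \<omega> - c * B n \<omega>)" for n \<omega>
  have [measurable]: "h n \<in> borel_measurable M" for n unfolding h_def by measurable
  have h_bound: "norm (h n \<omega>) \<le> 1 + \<bar>c\<bar>" for n \<omega>
  proof -
    have "\<bar>c * B n \<omega>\<bar> \<le> \<bar>c\<bar> * 1" unfolding abs_mult using B(2,3) by (intro mult_left_mono) auto
    then show ?thesis using A(2)[of n \<omega>] by (auto simp: h_def)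
  qed
  have int: "integrable M (A n)" "integrable M (B n)" "integrable M (h n)" for n
  proof -
    show "integrable M (A n)" using A by (intro integrable_const_bound[of _ 1]) auto
    show "integrable M (B n)" using B by (intro integrable_const_bound[of _ 1]) auto
    show "integrable M (h n)" using h_bound by (intro integrable_const_bound[of _ "1 + \<bar>c\<bar>"]) auto
  qed
  have "(\<lambda>n. \<integral>\<omega>. h n \<omega> \<partial>M) \<longlonglongrightarrow> (\<integral>\<omega>. 0 \<partial>M)"
  proof (rule integral_dominated_convergence[where w = "\<lambda>_. 1 + \<bar>c\<bar>"])
    show "AE \<omega> in M. (\<lambda>n. h n \<omega>) \<longlonglongrightarrow> 0"
      using bound
    proof eventually_elim
      case (elim \<omega>)
      then obtain I where I: "I \<longlonglongrightarrow> c" "\<And>n. 1 \<le> n \<Longrightarrow> A n \<omega> \<le> I n * B n \<omega>" by blast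
      have "norm (h n \<omega>) \<le> \<bar>I n - c\<bar>" if "1 \<le> n" for n
      proof -
        have "A n \<omega> - c * B n \<omega> \<le> (I n - c) * B n \<omega>" using I(2)[OF that] by (simp add: algebra_simps)
        also have "\<dots> \<le> \<bar>I n - c\<bar> * 1" using B(2,3) by (intro mult_mono) auto
        finally show ?thesis by (simp add: h_def)
      qed
      then have "eventually (\<lambda>n. norm (h n \<omega>) \<le> \<bar>I n - c\<bar>) sequentially"
        by (rule eventually_sequentiallyI)
      moreover have "(\<lambda>n. \<bar>I n - c\<bar>) \<longlonglongrightarrow> 0"
        using I(1) by (simp add: tendsto_rabs_zero_iff LIM_zero_iff)
      ultimately show ?case by (rule Lim_null_comparison)
    qed
  qed (use h_bound in simp_all)
  moreover have "(\<integral>\<omega>. A n \<omega> \<partial>M) - c * (\<integral>\<omega>. B n \<omega> \<partial>M) \<le> (\<integral>\<omega>. h n \<omega> \<partial>M)" for n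
  proof -
    have "(\<integral>\<omega>. A n \<omega> \<partial>M) - c * (\<integral>\<omega>. B n \<omega> \<partial>M) = (\<integral>\<omega>. A n \<omega> - c * B n \<omega> \<partial>M)"
      using int by simp
    also have "\<dots> \<le> (\<integral>\<omega>. h n \<omega> \<partial>M)"
      using int by (intro integral_mono) (simp_all add: h_def)
    finally show ?thesis .
  qed
  moreover have "(\<lambda>n. (\<integral>\<omega>. A n \<omega> \<partial>M) - c * (\<integral>\<omega>. B n \<omega> \<partial>M)) \<longlonglongrightarrow> a - c * b"
    by (intro tendsto_intros lim_A lim_B)
  ultimately have "a - c * b \<le> (\<integral>\<omega>. 0 \<partial>M)"
    by (intro LIMSEQ_le[where Y = "\<lambda>n. \<integral>\<omega>. h n \<omega> \<partial>M"]) auto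
  then show ?thesis by simp
qed

lemma persists_cong:
  assumes "0 \<le> l" "i \<in> {1..n}" "\<And>k. k \<in> {1..n} \<Longrightarrow> x k = x' k"
  shows "persists n x l i = persists n x' l i"
proof -
  have "survives l (x i) (rev [1..<i]) x = survives l (x i) (rev [1..<i]) x'"
    "survives l (x i) [Suc i..<Suc n] x = survives l (x i) [Suc i..<Suc n] x'"
    using assms by (auto intro!: survives_cong simp del: upt_Suc)
  then show ?thesis unfolding persists_iff_survives[OF assms(1,2)] using assms(2,3) by simp
qed

locale iid_sequence = prob_space P for P :: "'a measure" +
  fixes X :: "nat \<Rightarrow> 'a \<Rightarrow> real" and \<mu> :: "real measure"
  assumes indep: "indep_vars (\<lambda>_. borel) X {1..}"
    and ident: "1 \<le> k \<Longrightarrow> distr P borel (X k) = \<mu>"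
    and atomless: "atomless_distribution \<mu>"
begin

sublocale \<mu>: atomless_distribution \<mu> by (rule atomless)

lemma X_measurable: "1 \<le> k \<Longrightarrow> X k \<in> borel_measurable P"
  using indep by (simp add: indep_vars_def2)

lemma joint_distribution:
  assumes I: "I \<subseteq> {1..}" "I \<noteq> {}"
  shows "distr P (PiM I (\<lambda>_. borel)) (\<lambda>\<omega>. \<lambda>k\<in>I. X k \<omega>) = PiM I (\<lambda>_. \<mu>)"
proof -
  have "indep_vars (\<lambda>_. borel) X I" using indep I(1) by (rule indep_vars_subset)
  then have "distr P (PiM I (\<lambda>_. borel)) (\<lambda>\<omega>. \<lambda>k\<in>I. X k \<omega>) = PiM I (\<lambda>k. distr P borel (X k))"
    using I X_measurable by (subst (asm) indep_vars_iff_distr_eq_PiM') auto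
  also have "\<dots> = PiM I (\<lambda>_. \<mu>)" using I ident by (intro PiM_cong) auto
  finally show ?thesis .
qed

lemma restrict_measurable:
  assumes "I \<subseteq> {1..}"
  shows "(\<lambda>\<omega>. \<lambda>k\<in>I. X k \<omega>) \<in> measurable P (PiM I (\<lambda>_. borel))"
  using assms X_measurable by (intro measurable_restrict) auto

text \<open>
  On the product of two copies of an atomless distribution, the diagonal is a null set.
\<close>

lemma AE_distinct: "AE \<omega> in P. \<forall>n. inj_on (\<lambda>k. X k \<omega>) {1..n}"
proof -
  have "AE \<omega> in P. X j \<omega> \<noteq> X k \<omega>" if jk: "1 \<le> j" "1 \<le> k" "j \<noteq> k" for j k
  proof -
    interpret S: product_sigma_finite "\<lambda>_. \<mu>" by standard
    have comp: "(\<lambda>x. x i) \<in> borel_measurable (PiM {j, k} (\<lambda>_. \<mu>))" if "i \<in> {j, k}" for i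
      using measurable_component_singleton[OF that, of "\<lambda>_. \<mu>"]
      by (simp only: measurable_cong_sets[OF refl \<mu>.events_eq_borel])
    have sets: "sets (PiM {j, k} (\<lambda>_. \<mu>)) = sets (PiM {j, k} (\<lambda>_. borel))"
      by (intro sets_PiM_cong) simp_all
    have [measurable]: "Measurable.pred (PiM {j, k} (\<lambda>_. \<mu>)) (\<lambda>x. x j = x k)"
      unfolding pred_def by (intro borel_measurable_eq comp) simp_all
    have meas: "(\<lambda>x. of_bool (x j = x k) :: ennreal) \<in> borel_measurable (PiM {j, k} (\<lambda>_. \<mu>))"
      by measurable
    have "(\<integral>\<^sup>+x. of_bool (x j = x k) \<partial>PiM {j, k} (\<lambda>_. \<mu>)) =
        (\<integral>\<^sup>+b. \<integral>\<^sup>+x. of_bool ((x(j := b)) j = (x(j := b)) k) \<partial>PiM {k} (\<lambda>_. \<mu>) \<partial>\<mu>)"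
      using jk meas by (intro S.product_nn_integral_insert_rev) auto
    also have "\<dots> = (\<integral>\<^sup>+b. \<integral>\<^sup>+a. of_bool (a = b) \<partial>\<mu> \<partial>\<mu>)"
    proof (intro nn_integral_cong)
      fix b
      have "(\<lambda>a. of_bool (a = b) :: ennreal) \<in> borel_measurable \<mu>" by measurable
      then have "(\<integral>\<^sup>+x. of_bool (x k = b) \<partial>PiM {k} (\<lambda>_. \<mu>)) = (\<integral>\<^sup>+a. of_bool (a = b) \<partial>\<mu>)"
        by (rule S.product_nn_integral_singleton)
      then show "(\<integral>\<^sup>+x. of_bool ((x(j := b)) j = (x(j := b)) k) \<partial>PiM {k} (\<lambda>_. \<mu>)) =
          (\<integral>\<^sup>+a. of_bool (a = b) \<partial>\<mu>)"
        using jk(3) by (simp add: eq_commute)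
    qed
    also have "\<dots> = (\<integral>\<^sup>+b. emeasure \<mu> {b} \<partial>\<mu>)"
      by (intro nn_integral_cong) (simp add: indicator_def flip: nn_integral_indicator)
    also have "\<dots> = 0" by (simp add: \<mu>.emeasure_eq_measure \<mu>.no_atoms)
    finally have "AE x in PiM {j, k} (\<lambda>_. \<mu>). x j \<noteq> x k"
      by (subst (asm) nn_integral_0_iff_AE) auto
    then have "AE x in distr P (PiM {j, k} (\<lambda>_. borel)) (\<lambda>\<omega>. \<lambda>k\<in>{j, k}. X k \<omega>). x j \<noteq> x k"
      using jk by (subst joint_distribution) auto
    moreover have "(\<lambda>\<omega>. \<lambda>k\<in>{j, k}. X k \<omega>) \<in> measurable P (PiM {j, k} (\<lambda>_. borel))"
      using jk by (intro restrict_measurable) auto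
    ultimately show ?thesis by (subst (asm) AE_distr_iff) auto
  qed
  then have "AE \<omega> in P. \<forall>j k. 1 \<le> j \<longrightarrow> 1 \<le> k \<longrightarrow> j \<noteq> k \<longrightarrow> X j \<omega> \<noteq> X k \<omega>"
    by (simp add: AE_all_countable)
  then show ?thesis
  proof eventually_elim
    case (elim \<omega>)
    then have "j = k" if "1 \<le> j" "1 \<le> k" "X j \<omega> = X k \<omega>" for j k using that by metis
    then show ?case by (intro allI inj_onI) simp
  qed
qed

lemma persists_pred:
  assumes l: "0 \<le> l" and i: "i \<in> {1..n}"
  shows "Measurable.pred P (\<lambda>\<omega>. persists n (\<lambda>k. X k \<omega>) l i)"
    and "prob {\<omega> \<in> space P. persists n (\<lambda>k. X k \<omega>) l i} =
      (\<integral>y. \<mu>.survival_prob l y (i - 1) * \<mu>.survival_prob l y (n - i) \<partial>\<mu>)"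
proof -
  define T where "T \<omega> = (\<lambda>k\<in>{1..n}. X k \<omega>)" for \<omega>
  have T: "T \<in> measurable P (PiM {1..n} (\<lambda>_. borel))"
    unfolding T_def by (rule restrict_measurable) auto
  have distr: "distr P (PiM {1..n} (\<lambda>_. borel)) T = PiM {1..n} (\<lambda>_. \<mu>)"
    unfolding T_def using i by (intro joint_distribution) auto
  have sets: "sets (PiM {1..n} (\<lambda>_. \<mu>)) = sets (PiM {1..n} (\<lambda>_. borel))"
    by (intro sets_PiM_cong) simp_all
  have persists_T: "persists n (T \<omega>) l i = persists n (\<lambda>k. X k \<omega>) l i" for \<omega>
    using l i by (intro persists_cong) (simp_all add: T_def)
  let ?Q = "{x \<in> space (PiM {1..n} (\<lambda>_. \<mu>)). persists n x l i}"
  have Q: "?Q \<in> sets (PiM {1..n} (\<lambda>_. borel))"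
    using \<mu>.persists_measurable[OF l i] unfolding pred_def sets .
  have "T \<omega> \<in> space (PiM {1..n} (\<lambda>_. \<mu>))" if "\<omega> \<in> space P" for \<omega>
    using measurable_space[OF T that] sets_eq_imp_space_eq[OF sets] by simp
  then have vimage: "T -` ?Q \<inter> space P = {\<omega> \<in> space P. persists n (\<lambda>k. X k \<omega>) l i}"
    using persists_T by auto
  show "Measurable.pred P (\<lambda>\<omega>. persists n (\<lambda>k. X k \<omega>) l i)"
    unfolding pred_def using measurable_sets[OF T Q] vimage by simp
  show "prob {\<omega> \<in> space P. persists n (\<lambda>k. X k \<omega>) l i} =
      (\<integral>y. \<mu>.survival_prob l y (i - 1) * \<mu>.survival_prob l y (n - i) \<partial>\<mu>)"
    using measure_distr[OF T Q] unfolding vimage distr \<mu>.prob_persists[OF l i] by simp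
qed

definition persistent_count :: "real \<Rightarrow> nat \<Rightarrow> 'a \<Rightarrow> nat" where
  "persistent_count l n \<omega> = card {i \<in> {1..n}. persists n (\<lambda>k. X k \<omega>) l i}"

lemma persistent_count_eq_sum:
  "real (persistent_count l n \<omega>) = (\<Sum>i\<in>{1..n}. of_bool (persists n (\<lambda>k. X k \<omega>) l i))"
  by (simp add: persistent_count_def Int_def)

lemma persistent_count_le: "persistent_count l n \<omega> \<le> n"
proof -
  have "persistent_count l n \<omega> \<le> card {1..n}"
    unfolding persistent_count_def by (intro card_mono) auto
  then show ?thesis by simp
qed

lemma persistent_count_measurable:
  assumes "0 \<le> l"
  shows "(\<lambda>\<omega>. real (persistent_count l n \<omega>)) \<in> borel_measurable P"
proof -
  have "(\<lambda>\<omega>. of_bool (persists n (\<lambda>k. X k \<omega>) l i) :: real) \<in> borel_measurable P" if "i \<in> {1..n}" for i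
    using persists_pred(1)[OF assms that] by measurable
  then show ?thesis unfolding persistent_count_eq_sum by (intro borel_measurable_sum)
qed

lemma expected_count:
  assumes l: "0 \<le> l"
  shows "expectation (\<lambda>\<omega>. real (persistent_count l n \<omega>)) =
    (\<integral>y. (\<Sum>i<n. \<mu>.survival_prob l y i * \<mu>.survival_prob l y (n - Suc i)) \<partial>\<mu>)"
proof -
  have ind: "expectation (\<lambda>\<omega>. of_bool (persists n (\<lambda>k. X k \<omega>) l i)) =
      prob {\<omega> \<in> space P. persists n (\<lambda>k. X k \<omega>) l i}"
    and int: "integrable P (\<lambda>\<omega>. of_bool (persists n (\<lambda>k. X k \<omega>) l i) :: real)"
    if "i \<in> {1..n}" for i
  proof -
    let ?A = "{\<omega> \<in> space P. persists n (\<lambda>k. X k \<omega>) l i}"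
    have A: "?A \<in> events" using persists_pred(1)[OF l that] by (simp add: pred_def)
    have "expectation (\<lambda>\<omega>. of_bool (persists n (\<lambda>k. X k \<omega>) l i)) = (expectation (indicator ?A) :: real)"
      by (intro Bochner_Integration.integral_cong) (auto simp: indicator_def)
    then show "expectation (\<lambda>\<omega>. of_bool (persists n (\<lambda>k. X k \<omega>) l i)) = prob ?A" using A by simp
    show "integrable P (\<lambda>\<omega>. of_bool (persists n (\<lambda>k. X k \<omega>) l i) :: real)"
      using persists_pred(1)[OF l that] by (intro integrable_const_bound[of _ 1]) (measurable, simp)
  qed
  have "expectation (\<lambda>\<omega>. real (persistent_count l n \<omega>)) =
      (\<Sum>i\<in>{1..n}. \<integral>y. \<mu>.survival_prob l y (i - 1) * \<mu>.survival_prob l y (n - i) \<partial>\<mu>)"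
    unfolding persistent_count_eq_sum
    by (subst Bochner_Integration.integral_sum) (use int ind persists_pred(2)[OF l] in auto)
  also have "\<dots> = (\<Sum>i<n. \<integral>y. \<mu>.survival_prob l y i * \<mu>.survival_prob l y (n - Suc i) \<partial>\<mu>)"
    by (simp add: sum.atLeast1_atMost_eq)
  also have "\<dots> = (\<integral>y. (\<Sum>i<n. \<mu>.survival_prob l y i * \<mu>.survival_prob l y (n - Suc i)) \<partial>\<mu>)"
  proof (rule Bochner_Integration.integral_sum[symmetric])
    fix i
    show "integrable \<mu> (\<lambda>y. \<mu>.survival_prob l y i * \<mu>.survival_prob l y (n - Suc i))"
      by (rule \<mu>.integrable_const_bound[of _ 1])
        (simp_all add: \<mu>.survival_prob_nonneg[OF l] \<mu>.survival_prob_le_1[OF l] abs_mult mult_le_one)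
  qed
  finally show ?thesis .
qed

lemma expected_fraction_tendsto:
  assumes l: "0 \<le> l"
  shows "(\<lambda>n. expectation (\<lambda>\<omega>. real (persistent_count l n \<omega>) / real n)) \<longlonglongrightarrow> \<mu>.long_fraction l"
  using \<mu>.survival_average_tendsto[OF l] by (simp add: expected_count[OF l])

text \<open>
  The integral of the test function, multiplied by the total number of points, lies between the
  numbers of points longer than \<open>l + e\<close> and longer than \<open>l\<close>. Since the total number per index has mean
  tending to 1/3, the bounds on \<open>c\<close> follow by comparing limits. The upper bound is the comparison
  applied to the negated quantities.
\<close>

lemma limit_between:
  assumes l: "0 \<le> l" and e: "0 < e"
    and D: "\<And>n \<omega>. 1 \<le> n \<Longrightarrow> \<omega> \<in> space P \<Longrightarrow>
      is_persistence_diagram (sequence_module 0 (\<lambda>k. X k \<omega>) n) (D n \<omega>)"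
    and c: "AE \<omega> in P. (\<lambda>n. \<integral>q. ramp l e q \<partial>normalized (diagram_measure (D n \<omega>))) \<longlonglongrightarrow> c"
  shows "3 * \<mu>.long_fraction (l + e) \<le> c" "c \<le> 3 * \<mu>.long_fraction l"
proof -
  define I where "I \<omega> n = (\<integral>q. ramp l e q \<partial>normalized (diagram_measure (D n \<omega>)))" for \<omega> n
  define A where "A l n \<omega> = real (persistent_count l n \<omega>) / real n" for l n \<omega>
  have bounds: "A (l + e) n \<omega> \<le> I \<omega> n * A 0 n \<omega> \<and> I \<omega> n * A 0 n \<omega> \<le> A l n \<omega>"
    if n: "1 \<le> n" and \<omega>: "\<omega> \<in> space P" and inj: "inj_on (\<lambda>k. X k \<omega>) {1..n}" for n \<omega>
  proof -
    note diagram = D[OF n \<omega>]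
    have D_Delta: "set_mset (D n \<omega>) \<subseteq> Delta" using diagram by (simp add: is_persistence_diagram_def)
    have count: "size {#q \<in># D n \<omega>. q \<in> Delta_longer l'#} = persistent_count l' n \<omega>" if "0 \<le> l'" for l'
      unfolding persistent_count_def using inj diagram that by (rule size_diagram_longer)
    have "Delta_longer 0 = Delta"
    proof -
      have "0 < snd q - fst q" if "q \<in> Delta" for q
        using that by (cases "fst q"; cases "snd q"; auto simp: Delta_def)
      then show ?thesis by (auto simp: mem_Delta_longer simp flip: zero_ereal_def)
    qed
    then have "{#q \<in># D n \<omega>. q \<in> Delta_longer 0#} = D n \<omega>"
      using D_Delta by (auto simp: filter_mset_eq_conv)
    then have total: "size (D n \<omega>) = persistent_count 0 n \<omega>" using count[of 0] by simp
    show ?thesis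
    proof (cases "D n \<omega> = {#}")
      \<comment> \<open>All counts vanish, so both bounds hold whatever the integral is.\<close>
      case True
      then show ?thesis using count[of l] count[of "l + e"] total l e by (simp add: A_def)
    next
      case False
      note norm = normalized_diagram_measure[OF D_Delta False]
      have meas: "measure (normalized (diagram_measure (D n \<omega>))) (Delta_longer l') * A 0 n \<omega> = A l' n \<omega>"
        if "0 \<le> l'" for l'
        using that False by (simp add: norm(3) Delta_longer_sets count total A_def flip: total)
      have "0 \<le> A 0 n \<omega>" by (simp add: A_def)
      then show ?thesis
        using integral_ramp_bounds[OF norm(1,2) l e, THEN mult_right_mono, of "A 0 n \<omega>"] meas[of l] meas[of "l + e"] l e
        by (simp add: I_def)
    qed
  qed
  have A_meas: "A l' n \<in> borel_measurable P" if "0 \<le> l'" for l' n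
    unfolding A_def using persistent_count_measurable[OF that] by measurable
  have A_bounds: "0 \<le> A l' n \<omega>" "A l' n \<omega> \<le> 1" for l' n \<omega>
    using persistent_count_le[of l' n \<omega>] by (simp_all add: A_def divide_le_eq)
  have A_lim: "(\<lambda>n. expectation (A l' n)) \<longlonglongrightarrow> \<mu>.long_fraction l'" if "0 \<le> l'" for l'
    using expected_fraction_tendsto[OF that] by (simp add: A_def[abs_def])
  have A_0_lim: "(\<lambda>n. expectation (A 0 n)) \<longlonglongrightarrow> 1 / 3"
    using A_lim[of 0] by (simp add: \<mu>.long_fraction_0)
  have good: "AE \<omega> in P. \<omega> \<in> space P \<and> I \<omega> \<longlonglongrightarrow> c \<and> (\<forall>n. inj_on (\<lambda>k. X k \<omega>) {1..n})"
    using AE_space c AE_distinct by eventually_elim (simp add: I_def[abs_def])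
  have "\<mu>.long_fraction (l + e) \<le> c * (1 / 3)"
  proof (rule limit_comparison[OF prob_space_axioms, where A = "A (l + e)" and B = "A 0"])
    show "AE \<omega> in P. \<exists>J. J \<longlonglongrightarrow> c \<and> (\<forall>n\<ge>1. A (l + e) n \<omega> \<le> J n * A 0 n \<omega>)"
      using good by eventually_elim (use bounds in blast)
  qed (use A_meas A_bounds A_lim A_0_lim l e in auto)
  then show "3 * \<mu>.long_fraction (l + e) \<le> c" by simp
  have "- \<mu>.long_fraction l \<le> - c * (1 / 3)"
  proof (rule limit_comparison[OF prob_space_axioms, where A = "\<lambda>n \<omega>. - A l n \<omega>" and B = "A 0"])
    show "AE \<omega> in P. \<exists>J. J \<longlonglongrightarrow> - c \<and> (\<forall>n\<ge>1. - A l n \<omega> \<le> J n * A 0 n \<omega>)"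
      using good
    proof eventually_elim
      case (elim \<omega>)
      then have "(\<lambda>n. - I \<omega> n) \<longlonglongrightarrow> - c" by (intro tendsto_minus) simp
      moreover have "\<forall>n\<ge>1. - A l n \<omega> \<le> - I \<omega> n * A 0 n \<omega>" using bounds elim by simp
      ultimately show ?case by blast
    qed
    show "(\<lambda>n. expectation (\<lambda>\<omega>. - A l n \<omega>)) \<longlonglongrightarrow> - \<mu>.long_fraction l"
      using tendsto_minus[OF A_lim[OF l]] by simp
  qed (use A_meas A_bounds A_0_lim l in auto)
  then show "c \<le> 3 * \<mu>.long_fraction l" by simp
qed

end

lemma atomless_distribution_density:
  assumes "prob_space M" "distributed M lborel X f"
  shows "atomless_distribution (distr M borel X)"
proof -
  interpret prob_space M by fact
  have X: "X \<in> borel_measurable M" using distributed_measurable[OF assms(2)] by simp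
  have "distr M borel X = distr M lborel X" by (rule distr_cong) simp_all
  also have "\<dots> = density lborel f" by (rule distributed_distr_eq_density[OF assms(2)])
  finally have eq: "distr M borel X = density lborel f" .
  have "emeasure (density lborel f) {x} = 0" for x
  proof -
    have "{x} \<in> null_sets lborel" by (simp add: null_sets_def)
    then show ?thesis
      using distributed_borel_measurable[OF assms(2)]
      by (simp add: emeasure_density nn_integral_null_set)
  qed
  then have no_atoms: "measure (distr M borel X) {x} = 0" for x
    by (simp add: eq measure_def)
  show ?thesis
    by (intro atomless_distribution.intro real_distribution_distr X atomless_distribution_axioms.intro no_atoms)
qed

theorem corollary3p5:
  fixes M :: "'a measure" and X :: "nat \<Rightarrow> 'a \<Rightarrow> real"
    and N :: "'b measure" and Y :: "'b \<Rightarrow> real"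
    and F :: "real \<Rightarrow> real"
    and D :: "nat \<Rightarrow> 'a \<Rightarrow> (ereal \<times> ereal) multiset"
    and \<xi> :: "(ereal \<times> ereal) measure"
    and l :: real
  assumes M: "prob_space M"
    and indep: "prob_space.indep_vars M (\<lambda>_. borel) X {1..}"
    and ident: "\<And>k. k \<ge> 1 \<Longrightarrow> distr M borel (X k) = distr M borel (X 1)"
    and density: "\<exists>f. distributed M lborel (X 1) f"
    and F: "F = cdf (distr M borel (X 1))"
    and diagram: "\<And>n \<omega>. n \<ge> 1 \<Longrightarrow> \<omega> \<in> space M \<Longrightarrow>
           is_persistence_diagram (sequence_module 0 (\<lambda>k. X k \<omega>) n) (D n \<omega>)"
    and \<xi>_prob: "prob_space \<xi>"
    and \<xi>_sets: "sets \<xi> = sets (restrict_space borel Delta)"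
    and \<xi>_limit: "AE \<omega> in M.
           weakly_converges_on Delta (\<lambda>n. normalized (diagram_measure (D n \<omega>))) \<xi>"
    and N: "prob_space N"
    and Y_meas: "Y \<in> borel_measurable N"
    and Y_distr: "distr N borel Y = distr M borel (X 1)"
    and l: "l \<ge> 0"
  shows "measure \<xi> (Delta_longer l) =
         3 * (\<integral>\<omega>. ((1 - F (Y \<omega> + l)) / (1 - F (Y \<omega> + l) + F (Y \<omega>)))\<^sup>2 \<partial>N)"
proof -
  define \<mu> where "\<mu> = distr M borel (X 1)"
  obtain f where f: "distributed M lborel (X 1) f" using density by blast
  interpret iid_sequence M X \<mu>
    unfolding \<mu>_def
    by (intro iid_sequence.intro iid_sequence_axioms.intro M indep ident atomless_distribution_density[OF M f])
  have limit: "3 * \<mu>.long_fraction (l + e) \<le> (\<integral>q. ramp l e q \<partial>\<xi>)"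
    "(\<integral>q. ramp l e q \<partial>\<xi>) \<le> 3 * \<mu>.long_fraction l" if e: "0 < e" for e
  proof -
    have "0 \<le> ramp l e q \<and> ramp l e q \<le> 1" if "q \<in> Delta" for q
      using ramp_nonneg[OF l e, of q] ramp_le_indicator[OF l e that]
      by (cases "q \<in> Delta_longer l") simp_all
    then have "bounded (ramp l e ` Delta)"
      by (intro boundedI[of _ 1]) auto
    then have "AE \<omega> in M. (\<lambda>n. \<integral>q. ramp l e q \<partial>normalized (diagram_measure (D n \<omega>)))
        \<longlonglongrightarrow> (\<integral>q. ramp l e q \<partial>\<xi>)"
      using \<xi>_limit continuous_on_ramp[OF l e]
      by (auto elim!: eventually_mono simp: weakly_converges_on_def)
    from limit_between[OF l e diagram this]
    show "3 * \<mu>.long_fraction (l + e) \<le> (\<integral>q. ramp l e q \<partial>\<xi>)"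
      "(\<integral>q. ramp l e q \<partial>\<xi>) \<le> 3 * \<mu>.long_fraction l" by simp_all
  qed
  have "measure \<xi> (Delta_longer l) = 3 * \<mu>.long_fraction l"
  proof (rule antisym)
    have "measure \<xi> (Delta_longer (l + 1 / real (Suc n))) \<le> 3 * \<mu>.long_fraction l" for n
      using integral_ramp_bounds(1)[OF \<xi>_prob \<xi>_sets l, of "1 / real (Suc n)"] limit(2)[of "1 / real (Suc n)"]
      by simp
    then show "measure \<xi> (Delta_longer l) \<le> 3 * \<mu>.long_fraction l"
      by (intro LIMSEQ_le_const2[OF measure_Delta_longer_tendsto[OF \<xi>_prob \<xi>_sets l]]) auto
    have "3 * \<mu>.long_fraction (l + 1 / real (Suc n)) \<le> measure \<xi> (Delta_longer l)" for n
      using integral_ramp_bounds(2)[OF \<xi>_prob \<xi>_sets l, of "1 / real (Suc n)"] limit(1)[of "1 / real (Suc n)"]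
      by simp
    then show "3 * \<mu>.long_fraction l \<le> measure \<xi> (Delta_longer l)"
      by (intro LIMSEQ_le_const2[OF tendsto_mult_left[OF \<mu>.long_fraction_right_continuous[OF l]]]) auto
  qed
  also have "\<mu>.long_fraction l = (\<integral>\<omega>. ((1 - F (Y \<omega> + l)) / (1 - F (Y \<omega> + l) + F (Y \<omega>)))\<^sup>2 \<partial>N)"
  proof -
    have "(\<lambda>y. ((1 - F (y + l)) / (1 - F (y + l) + F y))\<^sup>2) \<in> borel_measurable borel"
      unfolding F \<mu>_def[symmetric] by measurable
    from integral_distr[OF Y_meas this]
    show ?thesis unfolding Y_distr \<mu>.long_fraction_def F \<mu>_def[symmetric] .
  qed
  finally show ?thesis .
qed

end
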